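(* Let $R$ be an integral domain with quotient field $K$, $R\neq K$, and assume that each $t$-linked overring of $R$ is $w$-divisorial. Then $R$ is a Mori domain if and only if $R$ has $t$-dimension one.
   Context: For a domain $D$ with quotient field $K\neq D$ and fractional ideals $I,J$, put $(J:I)=\{x\in K: xI\subseteq J\}$. For a nonzero fractional ideal $I$ of $D$: $I_v=(D:(D:I))$; $I_t=\bigcup J_v$, the union over nonzero finitely generated fractional ideals $J\subseteq I$. $I$ is divisorial if $I=I_v$, a $t$-ideal if $I=I_t$. A $t$-prime is a nonzero prime ideal that is a $t$-ideal; a $t$-maximal ideal is an ideal maximal among the proper integral $t$-ideals (it is prime); $t\text{-Max}(D)$ is the set of these. $I_w=\bigcap_{M\in t\text{-Max}(D)}ID_M$, and $I$ is a $w$-ideal if $I=I_w$. $D$ is $w$-divisorial if every $w$-ideal is divisorial; a field is regarded as (trivially) $w$-divisorial. $D$ has $t$-dimension one if each $t$-prime ideal has height one. $D$ is Mori if it satisfies the ascending chain condition on proper divisorial ideals. An overring of $R$ is a ring $T$ with $R\subseteq T\subseteq K$; it is $t$-linked over $R$ if for each nonzero finitely generated ideal $J$ of $R$ with $(R:J)=R$ one has $(T:JT)=T$. *)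

theory Defs
  imports Complex_Main "HOL-Library.Extended_Nat"
begin

text \<open>
  The quotient field \<open>K\<close> is the universe of a type of class \<^class>\<open>field\<close>; integral domains
  with quotient field \<open>K\<close>, their overrings, localizations and fractional ideals are subsets of it.
\<close>

definition subring_of_field :: "'a::field set \<Rightarrow> bool" where
  "subring_of_field D \<longleftrightarrow> 1 \<in> D \<and> (\<forall>x\<in>D. \<forall>y\<in>D. x - y \<in> D \<and> x * y \<in> D)"

definition domain_with_quotient_field :: "'a::field set \<Rightarrow> bool" where
  "domain_with_quotient_field D \<longleftrightarrow>
     subring_of_field D \<and> (\<forall>x. \<exists>a\<in>D. \<exists>b\<in>D. b \<noteq> 0 \<and> x = a / b)"

definition overring :: "'a::field set \<Rightarrow> 'a set \<Rightarrow> bool" where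
  "overring R T \<longleftrightarrow> subring_of_field T \<and> R \<subseteq> T"

definition submodule :: "'a::field set \<Rightarrow> 'a set \<Rightarrow> bool" where
  "submodule D I \<longleftrightarrow>
     0 \<in> I \<and> (\<forall>x\<in>I. \<forall>y\<in>I. x + y \<in> I) \<and> (\<forall>d\<in>D. \<forall>x\<in>I. d * x \<in> I)"

text \<open>
  The \<open>D\<close>-submodule of \<open>K\<close> generated by \<open>S\<close>. In particular, for an ideal \<open>I\<close> of \<open>D\<close> and an
  overring \<open>T\<close> of \<open>D\<close>, the extension \<open>I T\<close> is \<open>span_over T I\<close>.
\<close>
definition span_over :: "'a::field set \<Rightarrow> 'a set \<Rightarrow> 'a set" where
  "span_over D S = submodule D hull S"

definition fin_gen :: "'a::field set \<Rightarrow> 'a set \<Rightarrow> bool" where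
  "fin_gen D I \<longleftrightarrow> (\<exists>S. finite S \<and> I = span_over D S)"

definition fractional_ideal :: "'a::field set \<Rightarrow> 'a set \<Rightarrow> bool" where
  "fractional_ideal D I \<longleftrightarrow> submodule D I \<and> (\<exists>d\<in>D. d \<noteq> 0 \<and> (\<forall>x\<in>I. d * x \<in> D))"

definition integral_ideal :: "'a::field set \<Rightarrow> 'a set \<Rightarrow> bool" where
  "integral_ideal D I \<longleftrightarrow> submodule D I \<and> I \<subseteq> D"

definition prime_ideal :: "'a::field set \<Rightarrow> 'a set \<Rightarrow> bool" where
  "prime_ideal D P \<longleftrightarrow>
     integral_ideal D P \<and> P \<noteq> D \<and> (\<forall>x\<in>D. \<forall>y\<in>D. x * y \<in> P \<longrightarrow> x \<in> P \<or> y \<in> P)"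

text \<open>The length of a chain of primes is its number of strict inclusions; \<open>{0}\<close> is a prime of
  \<open>D\<close>, so it may occur in such a chain.\<close>
definition height :: "'a::field set \<Rightarrow> 'a set \<Rightarrow> enat" where
  "height D P = Sup {enat n |n. \<exists>C :: nat \<Rightarrow> 'a set.
     (\<forall>i\<le>n. prime_ideal D (C i)) \<and> (\<forall>i<n. C i \<subset> C (Suc i)) \<and> C n = P}"

definition colon :: "'a::field set \<Rightarrow> 'a set \<Rightarrow> 'a set" where
  "colon J I = {x. \<forall>y\<in>I. x * y \<in> J}"

definition v_closure :: "'a::field set \<Rightarrow> 'a set \<Rightarrow> 'a set" where
  "v_closure D I = colon D (colon D I)"

definition t_closure :: "'a::field set \<Rightarrow> 'a set \<Rightarrow> 'a set" where
  "t_closure D I =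
     \<Union> {v_closure D J |J. fractional_ideal D J \<and> J \<noteq> {0} \<and> fin_gen D J \<and> J \<subseteq> I}"

definition divisorial :: "'a::field set \<Rightarrow> 'a set \<Rightarrow> bool" where
  "divisorial D I \<longleftrightarrow> fractional_ideal D I \<and> I \<noteq> {0} \<and> I = v_closure D I"

definition t_ideal :: "'a::field set \<Rightarrow> 'a set \<Rightarrow> bool" where
  "t_ideal D I \<longleftrightarrow> fractional_ideal D I \<and> I \<noteq> {0} \<and> I = t_closure D I"

definition t_prime :: "'a::field set \<Rightarrow> 'a set \<Rightarrow> bool" where
  "t_prime D P \<longleftrightarrow> prime_ideal D P \<and> P \<noteq> {0} \<and> t_ideal D P"

definition t_Max :: "'a::field set \<Rightarrow> 'a set set" where
  "t_Max D = {M. t_ideal D M \<and> M \<subset> D \<and> (\<forall>I. t_ideal D I \<and> I \<subset> D \<and> M \<subseteq> I \<longrightarrow> I = M)}"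

definition localization_at :: "'a::field set \<Rightarrow> 'a set \<Rightarrow> 'a set" where
  "localization_at D M = {a / s |a s. a \<in> D \<and> s \<in> D \<and> s \<notin> M}"

definition w_closure :: "'a::field set \<Rightarrow> 'a set \<Rightarrow> 'a set" where
  "w_closure D I = (\<Inter>M\<in>t_Max D. span_over (localization_at D M) I)"

definition w_ideal :: "'a::field set \<Rightarrow> 'a set \<Rightarrow> bool" where
  "w_ideal D I \<longleftrightarrow> fractional_ideal D I \<and> I \<noteq> {0} \<and> I = w_closure D I"

text \<open>
  A domain with quotient field \<open>K\<close> that is a field equals \<open>K\<close>. That case is covered by
  convention; there \<open>t_Max D\<close> is empty and \<^const>\<open>w_closure\<close> has no meaning.
\<close>
definition w_divisorial :: "'a::field set \<Rightarrow> bool" where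
  "w_divisorial D \<longleftrightarrow> D = UNIV \<or> (\<forall>I. w_ideal D I \<longrightarrow> divisorial D I)"

definition t_dimension_one :: "'a::field set \<Rightarrow> bool" where
  "t_dimension_one D \<longleftrightarrow> (\<forall>P. t_prime D P \<longrightarrow> height D P = 1)"

text \<open>Proper divisorial ideals are integral ideals different from \<open>D\<close>.\<close>
definition Mori :: "'a::field set \<Rightarrow> bool" where
  "Mori D \<longleftrightarrow> (\<forall>C :: nat \<Rightarrow> 'a set.
     (\<forall>n. divisorial D (C n) \<and> C n \<subset> D) \<and> (\<forall>n. C n \<subseteq> C (Suc n)) \<longrightarrow>
     (\<exists>N. \<forall>n\<ge>N. C n = C N))"

definition t_linked_overring :: "'a::field set \<Rightarrow> 'a set \<Rightarrow> bool" where
  "t_linked_overring R T \<longleftrightarrow> overring R T \<and>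
     (\<forall>J. integral_ideal R J \<and> J \<noteq> {0} \<and> fin_gen R J \<and> colon R J = R \<longrightarrow>
        colon T (span_over T J) = T)"

end

theory Submission
  imports Defs
begin

text \<open>
  \<open>R\<close> itself is \<open>w\<close>-divisorial, so \<open>I\<^sub>w = I\<^sub>v\<close> for every nonzero fractional ideal. If \<open>R\<close> is Mori,
  a chain \<open>0 \<subset> Q \<subset> P\<close> with \<open>x \<in> Q\<close> and \<open>y \<in> P - Q\<close> is impossible, because the divisorial ideals
  \<open>(x, y\<^sup>k)\<^sub>w\<close> become stationary, which forces \<open>y\<^sup>k \<in> x R\<^sub>M\<close> at a \<open>t\<close>-maximal ideal \<open>M \<supseteq> P\<close>.

  Conversely, let \<open>R\<close> have \<open>t\<close>-dimension one. Divisoriality of \<open>w\<close>-ideals shows that a nonzero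
  element lies in only finitely many \<open>t\<close>-maximal ideals. All overrings of \<open>D = R\<^sub>M\<close> are \<open>t\<close>-linked
  over \<open>R\<close>, so \<open>D\<close> and, if its maximal ideal \<open>N\<close> is not principal, also \<open>T = (N : N) = D + z D\<close> are
  divisorial. Therefore \<open>N\<close> is invertible in \<open>T\<close>, hence finitely generated, and \<open>D\<close> is Noetherian by
  Cohen's theorem. A chain of divisorial ideals containing \<open>x \<noteq> 0\<close> is determined by its
  localizations at the finitely many \<open>M\<close> containing \<open>x\<close>, and each of these becomes stationary.
\<close>

section \<open>Submodules and closure operations\<close>

lemma colon_mono: "I' \<subseteq> I \<Longrightarrow> J \<subseteq> J' \<Longrightarrow> colon J I \<subseteq> colon J' I'"
  unfolding colon_def by auto

lemma colonD: "u \<in> colon J I \<Longrightarrow> y \<in> I \<Longrightarrow> u * y \<in> J"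
  unfolding colon_def by auto

lemma colon_subset: "1 \<in> I \<Longrightarrow> colon J I \<subseteq> J"
  using colonD[of _ J I 1] by auto

lemma v_closure_mono: "I \<subseteq> J \<Longrightarrow> v_closure D I \<subseteq> v_closure D J"
  unfolding v_closure_def by (intro colon_mono order_refl)

lemma subset_v_closure: "I \<subseteq> v_closure D I"
  unfolding v_closure_def colon_def by (auto simp: mult.commute)

lemma v_closure_colon [simp]: "v_closure D (colon D X) = colon D X"
proof
  show "v_closure D (colon D X) \<subseteq> colon D X"
    using colon_mono[OF subset_v_closure[of X D] order_refl, of D]
    unfolding v_closure_def .
qed (rule subset_v_closure)

lemma v_closure_idem: "v_closure D (v_closure D X) = v_closure D X"
  using v_closure_colon[of D "colon D X"] unfolding v_closure_def[of D X] .

lemma submoduleD: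
  assumes "submodule D I"
  shows "0 \<in> I" "x \<in> I \<Longrightarrow> y \<in> I \<Longrightarrow> x + y \<in> I" "d \<in> D \<Longrightarrow> x \<in> I \<Longrightarrow> d * x \<in> I"
  using assms unfolding submodule_def by auto

lemma submodule_span_over: "submodule D (span_over D S)"
  unfolding span_over_def hull_def submodule_def by auto

lemma span_over_superset: "S \<subseteq> span_over D S"
  unfolding span_over_def by (rule hull_subset)

lemma span_over_minimal: "S \<subseteq> I \<Longrightarrow> submodule D I \<Longrightarrow> span_over D S \<subseteq> I"
  unfolding span_over_def by (rule hull_minimal)

lemma span_over_mono: "S \<subseteq> S' \<Longrightarrow> span_over D S \<subseteq> span_over D S'"
  unfolding span_over_def by (rule hull_mono)

lemma span_over_empty: "span_over D {} = {0}"
proof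
  show "span_over D {} \<subseteq> {0}"
    by (rule span_over_minimal) (auto simp: submodule_def)
qed (simp add: submoduleD(1)[OF submodule_span_over])

lemma submodule_neq_zeroE:
  assumes "submodule D I" "I \<noteq> {0}"
  obtains c where "c \<in> I" "c \<noteq> 0"
  using assms submoduleD(1) by blast

lemma integral_ideal_Union_chain:
  assumes C: "C \<noteq> {}" "subset.chain A C" and A: "\<And>J. J \<in> A \<Longrightarrow> integral_ideal D J"
  shows "integral_ideal D (\<Union>C)"
proof -
  have CA: "\<And>J. J \<in> C \<Longrightarrow> submodule D J \<and> J \<subseteq> D"
    using C A unfolding subset.chain_def integral_ideal_def by blast
  have "submodule D (\<Union>C)"
    unfolding submodule_def
  proof (intro conjI ballI)
    show "0 \<in> \<Union>C" using CA C(1) submoduleD(1) by blast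
    show "x + y \<in> \<Union>C" if "x \<in> \<Union>C" "y \<in> \<Union>C" for x y
    proof -
      have "finite {x, y}" "{x, y} \<subseteq> \<Union>C" using that by auto
      then obtain J where "J \<in> C" "{x, y} \<subseteq> J"
        using finite_subset_Union_chain[OF _ _ C] by metis
      then show ?thesis using CA[of J] submoduleD(2)[of D J x y] by blast
    qed
    show "d * x \<in> \<Union>C" if "d \<in> D" "x \<in> \<Union>C" for d x
      using that CA submoduleD(3) by blast
  qed
  then show ?thesis unfolding integral_ideal_def using CA by blast
qed

lemma prime_ideal_power:
  assumes "prime_ideal D P" "y \<in> D" "1 \<in> D" "\<And>k. y ^ k \<in> D" "y ^ n \<in> P"
  shows "y \<in> P"
  using assms(5)
proof (induction n)
  case 0
  then have "1 \<in> P" by simp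
  then have "D \<subseteq> P"
    using assms(1) submoduleD(3)[of D P _ 1] unfolding prime_ideal_def integral_ideal_def by auto
  then show ?case using assms(2) by auto
next
  case (Suc n)
  then show ?case using assms unfolding prime_ideal_def by auto
qed

section \<open>Modules, colons and fractional ideals of a domain in its quotient field\<close>

locale domain_in_field =
  fixes D :: "'a::field set"
  assumes dom: "domain_with_quotient_field D"
begin

lemma one_mem [simp]: "1 \<in> D"
  and diff_mem: "x \<in> D \<Longrightarrow> y \<in> D \<Longrightarrow> x - y \<in> D"
  and mult_mem: "x \<in> D \<Longrightarrow> y \<in> D \<Longrightarrow> x * y \<in> D"
  using dom unfolding domain_with_quotient_field_def subring_of_field_def by auto

lemma zero_mem [simp]: "0 \<in> D"
  using diff_mem[of 1 1] by simp

lemma uminus_mem: "x \<in> D \<Longrightarrow> - x \<in> D"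
  using diff_mem[of 0 x] by simp

lemma add_mem: "x \<in> D \<Longrightarrow> y \<in> D \<Longrightarrow> x + y \<in> D"
  using diff_mem[of x "- y"] uminus_mem by simp

lemma power_mem: "x \<in> D \<Longrightarrow> x ^ n \<in> D"
  by (induction n) (auto intro: mult_mem)

lemma quotientE:
  obtains a b where "a \<in> D" "b \<in> D" "b \<noteq> 0" "x = a / b"
  using dom unfolding domain_with_quotient_field_def by blast

lemma submodule_self: "submodule D D"
  unfolding submodule_def by (auto intro: add_mem mult_mem)

lemma submodule_diff: "submodule D I \<Longrightarrow> x \<in> I \<Longrightarrow> y \<in> I \<Longrightarrow> x - y \<in> I"
  using submoduleD(2)[of D I x "- y"] submoduleD(3)[of D I "- 1" y] uminus_mem[OF one_mem]
  by simp

lemma submodule_colon: "submodule D J \<Longrightarrow> submodule D (colon J X)"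
  unfolding submodule_def colon_def by (auto simp: distrib_right mult.assoc)

text \<open>For fixed \<open>u\<close> the elements \<open>y\<close> with
  \<open>u * y \<in> J\<close> form a submodule, so a colon can be computed on generators. This lets
  finite sets stand for finitely generated ideals under v-closures.\<close>

lemma colon_span_over:
  assumes "submodule D J"
  shows "colon J (span_over D A) = colon J A"
proof
  show "colon J (span_over D A) \<subseteq> colon J A"
    by (rule colon_mono[OF span_over_superset order_refl])
  show "colon J A \<subseteq> colon J (span_over D A)"
  proof
    fix u assume "u \<in> colon J A"
    moreover have "submodule D {y. u * y \<in> J}"
      using assms unfolding submodule_def by (auto simp: distrib_left mult.left_commute)
    ultimately have "span_over D A \<subseteq> {y. u * y \<in> J}"
      by (intro span_over_minimal) (auto simp: colon_def)
    then show "u \<in> colon J (span_over D A)" unfolding colon_def by auto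
  qed
qed

lemma v_closure_span_over: "v_closure D (span_over D A) = v_closure D A"
  unfolding v_closure_def by (simp add: colon_span_over[OF submodule_self])

lemma colon_self [simp]: "colon D D = D"
  unfolding colon_def using mult_mem one_mem by (auto, metis mult.right_neutral one_mem)

lemma v_closure_self [simp]: "v_closure D D = D"
  by (simp add: v_closure_def)

lemma submodule_v_closure: "submodule D (v_closure D I)"
  unfolding v_closure_def by (intro submodule_colon submodule_self)

text \<open>The module \<open>I + a D\<close>: a principal ideal for \<open>I = {0}\<close>, the
  module generated by 1 and \<open>a\<close> for \<open>I = D\<close>, and otherwise an ideal
  enlarged by one element.\<close>

lemma submodule_plus_principal:
  assumes "submodule D I"
  shows "submodule D {q + a * r |q r. q \<in> I \<and> r \<in> D}"
  unfolding submodule_def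
proof (intro conjI ballI)
  show "0 \<in> {q + a * r |q r. q \<in> I \<and> r \<in> D}"
    using submoduleD(1)[OF assms] zero_mem by force
next
  fix x y assume "x \<in> {q + a * r |q r. q \<in> I \<and> r \<in> D}" "y \<in> {q + a * r |q r. q \<in> I \<and> r \<in> D}"
  then obtain q r q' r' where "x = q + a * r" "y = q' + a * r'" "q \<in> I" "r \<in> D" "q' \<in> I" "r' \<in> D"
    by auto
  then have "x + y = (q + q') + a * (r + r')" "q + q' \<in> I" "r + r' \<in> D"
    using assms by (auto simp: algebra_simps intro: submoduleD add_mem)
  then show "x + y \<in> {q + a * r |q r. q \<in> I \<and> r \<in> D}" by blast
next
  fix d x assume "d \<in> D" "x \<in> {q + a * r |q r. q \<in> I \<and> r \<in> D}"
  then obtain q r where "x = q + a * r" "q \<in> I" "r \<in> D" by auto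
  then have "d * x = d * q + a * (d * r)" "d * q \<in> I" "d * r \<in> D"
    using assms \<open>d \<in> D\<close> by (auto simp: algebra_simps intro: submoduleD mult_mem)
  then show "d * x \<in> {q + a * r |q r. q \<in> I \<and> r \<in> D}" by blast
qed

lemma submodule_residual:
  assumes "submodule D I"
  shows "submodule D {r \<in> D. r * z \<in> I}"
  using assms unfolding submodule_def
  by (auto simp: distrib_right mult.assoc intro: add_mem mult_mem)

lemma integral_imp_fractional: "integral_ideal D I \<Longrightarrow> fractional_ideal D I"
  unfolding integral_ideal_def fractional_ideal_def
  by (auto intro!: bexI[of _ 1])

lemma fractional_subset:
  "fractional_ideal D I \<Longrightarrow> submodule D J \<Longrightarrow> J \<subseteq> I \<Longrightarrow> fractional_ideal D J"
  unfolding fractional_ideal_def by blast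

lemma fractional_colon:
  assumes "c \<in> X" "c \<noteq> 0"
  shows "fractional_ideal D (colon D X)"
proof -
  obtain a b where ab: "a \<in> D" "b \<in> D" "b \<noteq> 0" "c = a / b" by (rule quotientE)
  have "a * u \<in> D" if "u \<in> colon D X" for u
  proof -
    have "u * c \<in> D" using that assms(1) unfolding colon_def by auto
    then have "b * (u * c) \<in> D" by (rule mult_mem[OF ab(2)])
    then show ?thesis using ab by (simp add: mult.commute)
  qed
  then show ?thesis
    unfolding fractional_ideal_def using submodule_colon[OF submodule_self] ab assms(2)
    by (auto intro!: bexI[of _ a])
qed

lemma fractional_v_closure:
  assumes "fractional_ideal D I"
  shows "fractional_ideal D (v_closure D I)"
proof -
  obtain d where "d \<in> D" "d \<noteq> 0" "\<forall>x\<in>I. d * x \<in> D"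
    using assms unfolding fractional_ideal_def by auto
  then have "d \<in> colon D I" unfolding colon_def by auto
  then show ?thesis unfolding v_closure_def using \<open>d \<noteq> 0\<close> by (rule fractional_colon)
qed

section \<open>t-closures, t-ideals and t-maximal ideals\<close>

lemma t_closure_iff:
  assumes "fractional_ideal D I" "I \<noteq> {0}"
  shows "z \<in> t_closure D I \<longleftrightarrow> (\<exists>A. finite A \<and> A \<subseteq> I \<and> z \<in> v_closure D A)"
proof
  assume "z \<in> t_closure D I"
  then obtain J where J: "fin_gen D J" "J \<subseteq> I" "z \<in> v_closure D J"
    unfolding t_closure_def by auto
  then obtain S where "finite S" "J = span_over D S" unfolding fin_gen_def by auto
  then show "\<exists>A. finite A \<and> A \<subseteq> I \<and> z \<in> v_closure D A"
    using J span_over_superset[of S D] v_closure_span_over by auto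
next
  assume "\<exists>A. finite A \<and> A \<subseteq> I \<and> z \<in> v_closure D A"
  then obtain A where A: "finite A" "A \<subseteq> I" "z \<in> v_closure D A" by auto
  have sub: "submodule D I" using assms(1) unfolding fractional_ideal_def by auto
  then obtain c where c: "c \<in> I" "c \<noteq> 0" using assms(2) by (rule submodule_neq_zeroE)
  \<comment> \<open>\<open>A\<close> may be empty or \<open>{0}\<close>; adjoining \<open>c\<close>
    makes the ideal nonzero and can only enlarge the v-closure.\<close>
  let ?J = "span_over D (insert c A)"
  have "?J \<subseteq> I" using A c sub by (intro span_over_minimal) auto
  moreover have "fin_gen D ?J" unfolding fin_gen_def using A by auto
  moreover have "?J \<noteq> {0}" using c span_over_superset[of "insert c A" D] by auto
  moreover have "fractional_ideal D ?J"
    using fractional_subset[OF assms(1) submodule_span_over \<open>?J \<subseteq> I\<close>] .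
  moreover have "z \<in> v_closure D ?J"
    using A(3) v_closure_mono[of A "insert c A" D] v_closure_span_over by auto
  ultimately show "z \<in> t_closure D I" unfolding t_closure_def by auto
qed

lemma subset_t_closure:
  assumes "fractional_ideal D I" "I \<noteq> {0}"
  shows "I \<subseteq> t_closure D I"
proof
  fix z assume "z \<in> I"
  then show "z \<in> t_closure D I"
    unfolding t_closure_iff[OF assms] using subset_v_closure[of "{z}" D]
    by (intro exI[of _ "{z}"]) auto
qed

lemma t_idealI:
  assumes "fractional_ideal D I" "I \<noteq> {0}"
    and "\<And>A z. finite A \<Longrightarrow> A \<subseteq> I \<Longrightarrow> z \<in> v_closure D A \<Longrightarrow> z \<in> I"
  shows "t_ideal D I"
proof -
  have "t_closure D I \<subseteq> I"
    unfolding subset_iff t_closure_iff[OF assms(1,2)] by (auto dest: assms(3))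
  then show ?thesis unfolding t_ideal_def using assms(1,2) subset_t_closure[OF assms(1,2)] by simp
qed

lemma t_idealD:
  assumes "t_ideal D I" "finite A" "A \<subseteq> I" "z \<in> v_closure D A"
  shows "z \<in> I"
proof -
  have "fractional_ideal D I" "I \<noteq> {0}" "t_closure D I = I"
    using assms(1) unfolding t_ideal_def by blast+
  then show ?thesis using t_closure_iff[of I z] assms(2-4) by metis
qed

lemma v_closed_imp_t_ideal:
  assumes "fractional_ideal D I" "I \<noteq> {0}" "v_closure D I = I"
  shows "t_ideal D I"
proof (rule t_idealI[OF assms(1,2)])
  fix A z assume "A \<subseteq> I" "z \<in> v_closure D A"
  then show "z \<in> I" using v_closure_mono[of A I D] assms(3) by auto
qed

lemma submodule_t_closure:
  assumes "fractional_ideal D I" "I \<noteq> {0}"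
  shows "submodule D (t_closure D I)"
  unfolding submodule_def
proof (intro conjI ballI)
  note iff = t_closure_iff[OF assms]
  show "0 \<in> t_closure D I"
    unfolding iff using submoduleD(1)[OF submodule_v_closure]
    by (intro exI[of _ "{}"]) simp
  show "x + y \<in> t_closure D I" if xy: "x \<in> t_closure D I" "y \<in> t_closure D I" for x y
  proof -
    obtain A B where "finite A" "A \<subseteq> I" "x \<in> v_closure D A" "finite B" "B \<subseteq> I" "y \<in> v_closure D B"
      using xy unfolding iff by auto
    moreover from this have "x \<in> v_closure D (A \<union> B)" "y \<in> v_closure D (A \<union> B)"
      using v_closure_mono[of A "A \<union> B" D] v_closure_mono[of B "A \<union> B" D] by auto
    ultimately show ?thesis
      unfolding iff by (intro exI[of _ "A \<union> B"]) (auto intro: submoduleD(2)[OF submodule_v_closure])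
  qed
  show "d * x \<in> t_closure D I" if "d \<in> D" "x \<in> t_closure D I" for d x
    using that submoduleD(3)[OF submodule_v_closure, of d x] unfolding iff by metis
qed

lemma t_closure_subset_self:
  assumes "integral_ideal D I" "I \<noteq> {0}"
  shows "t_closure D I \<subseteq> D"
proof
  fix z assume "z \<in> t_closure D I"
  then obtain A where "A \<subseteq> I" "z \<in> v_closure D A"
    unfolding t_closure_iff[OF integral_imp_fractional[OF assms(1)] assms(2)] by auto
  then show "z \<in> D"
    using v_closure_mono[of A D D] assms(1) v_closure_self unfolding integral_ideal_def by auto
qed

text \<open>Finite character: each of the finitely many elements of \<open>A\<close> lies in the
  v-closure of a finite subset of \<open>I\<close>, and the union of these subsets is again
  finite.\<close>

lemma t_ideal_t_closure:
  assumes "integral_ideal D I" "I \<noteq> {0}"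
  shows "t_ideal D (t_closure D I)"
proof (rule t_idealI)
  have fr: "fractional_ideal D I" by (rule integral_imp_fractional[OF assms(1)])
  note iff = t_closure_iff[OF fr assms(2)]
  show "fractional_ideal D (t_closure D I)"
    using submodule_t_closure[OF fr assms(2)] t_closure_subset_self[OF assms]
    by (intro integral_imp_fractional) (simp add: integral_ideal_def)
  have "0 \<in> I" using assms(1) by (auto simp: integral_ideal_def submodule_def)
  then show "t_closure D I \<noteq> {0}" using subset_t_closure[OF fr assms(2)] assms(2) by auto
  fix A z assume A: "finite A" "A \<subseteq> t_closure D I" "z \<in> v_closure D A"
  then have "\<forall>a\<in>A. \<exists>B. finite B \<and> B \<subseteq> I \<and> a \<in> v_closure D B" using iff by auto
  then obtain B where B: "\<And>a. a \<in> A \<Longrightarrow> finite (B a) \<and> B a \<subseteq> I \<and> a \<in> v_closure D (B a)"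
    by metis
  let ?B = "\<Union>a\<in>A. B a"
  have "A \<subseteq> v_closure D ?B"
  proof
    fix a assume "a \<in> A"
    then show "a \<in> v_closure D ?B" using B[of a] v_closure_mono[of "B a" ?B D] by auto
  qed
  then have "v_closure D A \<subseteq> v_closure D (v_closure D ?B)" by (rule v_closure_mono)
  also have "\<dots> = v_closure D ?B" by (rule v_closure_idem)
  finally have "z \<in> v_closure D ?B" using A(3) by auto
  then show "z \<in> t_closure D I" unfolding iff using B A(1) by (intro exI[of _ ?B]) auto
qed

text \<open>For \<open>x \<notin> M\<close> the residual \<open>(M : x)\<close> in \<open>D\<close>
  is a proper ideal containing \<open>M\<close>. It is a t-ideal because multiplication by
  \<open>x\<close> carries the v-closure of a finite set \<open>F\<close> into that of
  \<open>x F\<close>, so by maximality it equals \<open>M\<close>.\<close>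

lemma t_Max_prime:
  assumes "M \<in> t_Max D"
  shows "prime_ideal D M"
proof -
  have M: "t_ideal D M" "M \<subset> D" using assms unfolding t_Max_def by auto
  have sub: "submodule D M" and nz: "M \<noteq> {0}"
    using M(1) unfolding t_ideal_def fractional_ideal_def by blast+
  have "y \<in> M" if xy: "x \<in> D" "y \<in> D" "x * y \<in> M" "x \<notin> M" for x y
  proof -
    let ?A = "{r \<in> D. r * x \<in> M}"
    have MA: "M \<subseteq> ?A"
      using M(2) submoduleD(3)[OF sub xy(1)] by (auto simp: mult.commute[of _ x])
    have "t_ideal D ?A"
    proof (rule t_idealI)
      show "fractional_ideal D ?A"
        using submodule_residual[OF sub]
        by (intro integral_imp_fractional) (auto simp: integral_ideal_def)
      show "?A \<noteq> {0}" using MA nz submoduleD(1)[OF sub] by blast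
      fix F z assume F: "finite F" "F \<subseteq> ?A" "z \<in> v_closure D F"
      have "z \<in> D" using v_closure_mono[of F D D] F v_closure_self by auto
      have "z * x \<in> v_closure D ((\<lambda>f. f * x) ` F)"
        unfolding v_closure_def colon_def
      proof safe
        fix u assume "\<forall>y\<in>(\<lambda>f. f * x) ` F. u * y \<in> D"
        then have "u * x \<in> colon D F" unfolding colon_def by (auto simp: ac_simps)
        then show "z * x * u \<in> D"
          using F(3) unfolding v_closure_def colon_def[of D "colon D F"] by (auto simp: ac_simps)
      qed
      then have "z * x \<in> M" using F by (intro t_idealD[OF M(1)]) auto
      then show "z \<in> ?A" using \<open>z \<in> D\<close> by auto
    qed
    moreover have "?A \<subseteq> D" "1 \<notin> ?A" using xy by auto
    then have "?A \<subset> D" using one_mem by blast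
    ultimately have "?A = M" using assms MA unfolding t_Max_def by blast
    moreover have "y \<in> ?A" using xy by (simp add: mult.commute)
    ultimately show "y \<in> M" by simp
  qed
  then show ?thesis
    unfolding prime_ideal_def integral_ideal_def using M(2) sub by blast
qed

text \<open>Zorn's lemma applies because a finite subset of the union of a chain already lies in one
  member, which makes the union a t-ideal.\<close>

lemma t_Max_exists:
  assumes "t_ideal D I" "I \<subset> D"
  obtains M where "M \<in> t_Max D" "I \<subseteq> M"
proof -
  let ?A = "{J. t_ideal D J \<and> J \<subset> D \<and> I \<subseteq> J}"
  have "\<exists>M\<in>?A. \<forall>X\<in>?A. M \<subseteq> X \<longrightarrow> X = M"
  proof (rule subset_Zorn_nonempty)
    show "?A \<noteq> {}" using assms by auto
    fix C assume C: "C \<noteq> {}" "subset.chain ?A C"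
    then have CA: "\<And>J. J \<in> C \<Longrightarrow> t_ideal D J \<and> J \<subset> D \<and> I \<subseteq> J"
      unfolding subset.chain_def by auto
    then have subC: "\<And>J. J \<in> C \<Longrightarrow> submodule D J"
      unfolding t_ideal_def fractional_ideal_def by blast
    have fin: "\<exists>J\<in>C. F \<subseteq> J" if "finite F" "F \<subseteq> \<Union>C" for F
      using finite_subset_Union_chain[OF that C] by blast
    have int: "integral_ideal D (\<Union>C)"
      by (rule integral_ideal_Union_chain[OF C])
        (unfold integral_ideal_def t_ideal_def fractional_ideal_def, blast)
    have "\<Union>C \<subset> D"
    proof -
      have "1 \<notin> J" if "J \<in> C" for J
        using CA[OF that] subC[OF that] submoduleD(3)[of D J _ 1] by auto
      then show ?thesis using CA one_mem by blast
    qed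
    have "fractional_ideal D (\<Union>C)" by (rule integral_imp_fractional[OF int])
    moreover have "\<Union>C \<noteq> {0}"
    proof -
      obtain J where "J \<in> C" using C by auto
      then have "J \<noteq> {0}" "submodule D J" using CA subC unfolding t_ideal_def by blast+
      then show ?thesis using \<open>J \<in> C\<close> submodule_neq_zeroE[of D J] by (metis UnionI singletonD)
    qed
    moreover have "z \<in> \<Union>C" if "finite F" "F \<subseteq> \<Union>C" "z \<in> v_closure D F" for F z
      using fin[OF that(1,2)] CA t_idealD that by blast
    ultimately have "t_ideal D (\<Union>C)" by (rule t_idealI)
    then show "\<Union>C \<in> ?A" using \<open>\<Union>C \<subset> D\<close> CA C by blast
  qed
  then obtain M where "M \<in> ?A" and max: "\<forall>X\<in>?A. M \<subseteq> X \<longrightarrow> X = M" by blast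
  moreover from this have "M \<in> t_Max D" unfolding t_Max_def by blast
  ultimately show ?thesis using that by blast
qed

lemma t_Max_not_mem_one: "M \<in> t_Max D \<Longrightarrow> 1 \<notin> M"
proof -
  assume "M \<in> t_Max D"
  then have "submodule D M" "M \<subseteq> D" "M \<noteq> D"
    using t_Max_prime unfolding prime_ideal_def integral_ideal_def by auto
  then show "1 \<notin> M" using submoduleD(3)[of D M _ 1] by auto
qed

text \<open>If \<open>z \<notin> D\<close>, the denominator ideal \<open>(D : (1, z))\<close> is
  proper and divisorial, so some t-maximal ideal contains every denominator of \<open>z\<close>.
  Hence \<open>D\<close> is the intersection of its localizations at t-maximal ideals.\<close>

lemma Inter_t_Max_localizations:
  assumes "\<And>M. M \<in> t_Max D \<Longrightarrow> \<exists>s\<in>D - M. s * z \<in> D"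
  shows "z \<in> D"
proof (rule ccontr)
  assume "z \<notin> D"
  let ?I = "colon D {1, z}"
  obtain a b where ab: "a \<in> D" "b \<in> D" "b \<noteq> 0" "z = a / b" by (rule quotientE)
  have "b \<in> ?I" using ab unfolding colon_def by auto
  then have "?I \<noteq> {0}" using ab by auto
  moreover have "fractional_ideal D ?I" by (rule fractional_colon[of 1]) auto
  ultimately have "t_ideal D ?I" by (intro v_closed_imp_t_ideal) simp_all
  moreover have "?I \<subseteq> D" "1 \<notin> ?I" using \<open>z \<notin> D\<close> unfolding colon_def by auto
  then have "?I \<subset> D" using one_mem by blast
  ultimately obtain M where M: "M \<in> t_Max D" "?I \<subseteq> M" by (rule t_Max_exists)
  then show False using assms[OF M(1)] unfolding colon_def by auto
qed

section \<open>Localizations and the w-closure\<close>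

lemma subset_localization_at:
  assumes "1 \<notin> M"
  shows "D \<subseteq> localization_at D M"
proof
  fix a assume "a \<in> D"
  then have "a = a / 1 \<and> a \<in> D \<and> 1 \<in> D \<and> 1 \<notin> M" using assms by simp
  then show "a \<in> localization_at D M" unfolding localization_at_def by blast
qed

text \<open>Clearing denominators. Membership in an extension to a localization thereby becomes a
  condition inside \<open>I\<close>, the form in which w-closures are used from here on.\<close>

lemma span_over_localization:
  assumes "prime_ideal D M" "submodule D I"
  shows "span_over (localization_at D M) I = {z. \<exists>s\<in>D - M. s * z \<in> I}"
proof
  have M: "submodule D M" "M \<subset> D" "\<And>x y. x \<in> D \<Longrightarrow> y \<in> D \<Longrightarrow> x * y \<in> M \<Longrightarrow> x \<in> M \<or> y \<in> M"
    using assms(1) unfolding prime_ideal_def integral_ideal_def by auto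
  have one: "1 \<notin> M" using M submoduleD(3)[OF M(1), of _ 1] by auto
  have mult: "s * t \<in> D - M" if "s \<in> D - M" "t \<in> D - M" for s t
    using that M(3) mult_mem by blast
  have nz: "s \<noteq> 0" if "s \<in> D - M" for s using that submoduleD(1)[OF M(1)] by auto
  show "span_over (localization_at D M) I \<subseteq> {z. \<exists>s\<in>D - M. s * z \<in> I}"
  proof (rule span_over_minimal)
    show "I \<subseteq> {z. \<exists>s\<in>D - M. s * z \<in> I}" using one by (auto intro!: bexI[of _ 1])
    show "submodule (localization_at D M) {z. \<exists>s\<in>D - M. s * z \<in> I}"
      unfolding submodule_def
    proof (intro conjI ballI)
      show "0 \<in> {z. \<exists>s\<in>D - M. s * z \<in> I}"
        using one one_mem submoduleD(1)[OF assms(2)] by (auto simp del: one_mem)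
    next
      fix x y assume "x \<in> {z. \<exists>s\<in>D - M. s * z \<in> I}" "y \<in> {z. \<exists>s\<in>D - M. s * z \<in> I}"
      then obtain s t where st: "s \<in> D - M" "t \<in> D - M" "s * x \<in> I" "t * y \<in> I" by auto
      have "t * (s * x) + s * (t * y) \<in> I" using st assms(2) by (auto intro!: submoduleD)
      then have "s * t * (x + y) \<in> I" by (simp add: algebra_simps)
      then show "x + y \<in> {z. \<exists>s\<in>D - M. s * z \<in> I}" using mult[OF st(1,2)] by blast
    next
      fix d x assume "d \<in> localization_at D M" "x \<in> {z. \<exists>s\<in>D - M. s * z \<in> I}"
      then obtain a t s where st: "a \<in> D" "t \<in> D - M" "d = a / t" "s \<in> D - M" "s * x \<in> I"
        unfolding localization_at_def by auto
      have "a * (s * x) \<in> I" using st assms(2) by (auto intro!: submoduleD)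
      moreover have "s * t * (d * x) = a * (s * x)" using st nz[OF st(2)] by simp
      ultimately have "s * t * (d * x) \<in> I" by metis
      then show "d * x \<in> {z. \<exists>s\<in>D - M. s * z \<in> I}" using mult[OF st(4,2)] by blast
    qed
  qed
  show "{z. \<exists>s\<in>D - M. s * z \<in> I} \<subseteq> span_over (localization_at D M) I"
  proof safe
    fix z s assume s: "s \<in> D" "s \<notin> M" "s * z \<in> I"
    have "1 / s = 1 / s \<and> 1 \<in> D \<and> s \<in> D \<and> s \<notin> M" using s by simp
    then have "1 / s \<in> localization_at D M" unfolding localization_at_def by blast
    moreover have "s * z \<in> span_over (localization_at D M) I" using s span_over_superset by auto
    ultimately have "1 / s * (s * z) \<in> span_over (localization_at D M) I"
      by (rule submoduleD(3)[OF submodule_span_over])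
    then show "z \<in> span_over (localization_at D M) I" using nz[of s] s by simp
  qed
qed

lemma w_closure_iff:
  assumes "submodule D I"
  shows "z \<in> w_closure D I \<longleftrightarrow> (\<forall>M\<in>t_Max D. \<exists>s\<in>D - M. s * z \<in> I)"
  unfolding w_closure_def using span_over_localization[OF t_Max_prime assms] by auto

lemma subset_w_closure: "I \<subseteq> w_closure D I"
  unfolding w_closure_def using span_over_superset by blast

text \<open>For \<open>z\<close> in the w-closure and \<open>u \<in> (D : I)\<close>, the product
  \<open>z * u\<close> lies in every localization at a t-maximal ideal, hence in
  \<open>D\<close>.\<close>

lemma w_closure_subset_v_closure:
  assumes "submodule D I"
  shows "w_closure D I \<subseteq> v_closure D I"
proof
  fix z assume z: "z \<in> w_closure D I"
  have "z * u \<in> D" if u: "u \<in> colon D I" for u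
  proof (rule Inter_t_Max_localizations)
    fix M assume "M \<in> t_Max D"
    then obtain s where "s \<in> D - M" "s * z \<in> I" using z w_closure_iff[OF assms] by auto
    then show "\<exists>s\<in>D - M. s * (z * u) \<in> D"
      using u unfolding colon_def by (auto simp: ac_simps intro!: bexI[of _ s])
  qed
  then show "z \<in> v_closure D I" unfolding v_closure_def colon_def[of D "colon D I"] by auto
qed

lemma submodule_w_closure:
  assumes "submodule D I"
  shows "submodule D (w_closure D I)"
  unfolding submodule_def w_closure_iff[OF assms]
proof (intro conjI ballI)
  fix M assume M: "M \<in> t_Max D"
  have prime: "prime_ideal D M" by (rule t_Max_prime[OF M])
  then have sub: "submodule (localization_at D M) {z. \<exists>s\<in>D - M. s * z \<in> I}"
    using submodule_span_over span_over_localization[OF prime assms] by metis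
  have D: "D \<subseteq> localization_at D M"
    by (rule subset_localization_at[OF t_Max_not_mem_one[OF M]])
  show "\<exists>s\<in>D - M. s * 0 \<in> I" using submoduleD(1)[OF sub] by simp
  show "\<exists>s\<in>D - M. s * (x + y) \<in> I"
    if "x \<in> w_closure D I" "y \<in> w_closure D I" for x y
    using submoduleD(2)[OF sub, of x y] that M unfolding w_closure_iff[OF assms] by simp
  show "\<exists>s\<in>D - M. s * (d * x) \<in> I" if "d \<in> D" "x \<in> w_closure D I" for d x
    using submoduleD(3)[OF sub, of d x] that M D unfolding w_closure_iff[OF assms] by auto
qed

lemma w_closure_idem:
  assumes "submodule D I"
  shows "w_closure D (w_closure D I) = w_closure D I"
proof
  show "w_closure D (w_closure D I) \<subseteq> w_closure D I"
  proof
    fix z assume z: "z \<in> w_closure D (w_closure D I)"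
    show "z \<in> w_closure D I"
      unfolding w_closure_iff[OF assms]
    proof
      fix M assume M: "M \<in> t_Max D"
      obtain s where s: "s \<in> D - M" "s * z \<in> w_closure D I"
        using z M unfolding w_closure_iff[OF submodule_w_closure[OF assms]] by auto
      then obtain r where r: "r \<in> D - M" "r * (s * z) \<in> I"
        using M unfolding w_closure_iff[OF assms] by auto
      have "r * s \<in> D - M"
        using s r t_Max_prime[OF M] mult_mem unfolding prime_ideal_def by blast
      then show "\<exists>s\<in>D - M. s * z \<in> I" using r by (intro bexI[of _ "r * s"]) (auto simp: mult.assoc)
    qed
  qed
qed (rule subset_w_closure)

text \<open>The w-closure is itself a w-ideal, fractional because it lies in the v-closure. Once it
  is divisorial, it contains the v-closure of \<open>I\<close>.\<close>

lemma w_closure_eq_v_closure: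
  assumes "w_divisorial D" "D \<noteq> UNIV" "fractional_ideal D I" "I \<noteq> {0}"
  shows "w_closure D I = v_closure D I"
proof
  have sub: "submodule D I" using assms(3) unfolding fractional_ideal_def by simp
  show le: "w_closure D I \<subseteq> v_closure D I" by (rule w_closure_subset_v_closure[OF sub])
  have "w_closure D I \<noteq> {0}"
    using subset_w_closure[of I] assms(4) submoduleD(1)[OF sub] by blast
  then have "w_ideal D (w_closure D I)"
    unfolding w_ideal_def using w_closure_idem[OF sub]
      fractional_subset[OF fractional_v_closure[OF assms(3)] submodule_w_closure[OF sub] le] by simp
  then have "v_closure D (w_closure D I) = w_closure D I"
    using assms(1,2) unfolding w_divisorial_def divisorial_def by metis
  then show "v_closure D I \<subseteq> w_closure D I"
    using v_closure_mono[OF subset_w_closure] by metis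
qed

section \<open>Existence of primes and Cohen's criterion\<close>

text \<open>Krull's argument with Zorn's lemma. Maximality is kept in the conclusion because
  \<open>W = {1}\<close> then yields maximal ideals.\<close>

lemma prime_avoiding:
  assumes "integral_ideal D I" "1 \<in> W" "\<And>a b. a \<in> W \<Longrightarrow> b \<in> W \<Longrightarrow> a * b \<in> W" "I \<inter> W = {}"
  obtains Q where "prime_ideal D Q" "I \<subseteq> Q" "Q \<inter> W = {}"
    "\<And>J. integral_ideal D J \<Longrightarrow> Q \<subseteq> J \<Longrightarrow> J \<inter> W = {} \<Longrightarrow> J = Q"
proof -
  let ?A = "{J. integral_ideal D J \<and> I \<subseteq> J \<and> J \<inter> W = {}}"
  have "\<exists>Q\<in>?A. \<forall>X\<in>?A. Q \<subseteq> X \<longrightarrow> X = Q"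
  proof (rule subset_Zorn_nonempty)
    show "?A \<noteq> {}" using assms by auto
    fix C assume C: "C \<noteq> {}" "subset.chain ?A C"
    then have CA: "\<And>J. J \<in> C \<Longrightarrow> integral_ideal D J \<and> I \<subseteq> J \<and> J \<inter> W = {}"
      unfolding subset.chain_def by auto
    have "integral_ideal D (\<Union>C)"
      using integral_ideal_Union_chain[OF C] by auto
    then show "\<Union>C \<in> ?A" using CA C(1) by blast
  qed
  then obtain Q where "Q \<in> ?A" and max: "\<forall>X\<in>?A. Q \<subseteq> X \<longrightarrow> X = Q" by blast
  then have Q: "integral_ideal D Q" "I \<subseteq> Q" "Q \<inter> W = {}" by auto
  have subQ: "submodule D Q" and QD: "Q \<subseteq> D" using Q(1) unfolding integral_ideal_def by auto
  have ext: "\<exists>w\<in>W. \<exists>q\<in>Q. \<exists>r\<in>D. w = q + a * r" if a: "a \<in> D" "a \<notin> Q" for a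
  proof (rule ccontr)
    let ?J = "{q + a * r |q r. q \<in> Q \<and> r \<in> D}"
    assume no: "\<not> (\<exists>w\<in>W. \<exists>q\<in>Q. \<exists>r\<in>D. w = q + a * r)"
    have "q + a * 0 \<in> ?J" if "q \<in> Q" for q using that zero_mem by blast
    then have "Q \<subseteq> ?J" by auto
    moreover have "integral_ideal D ?J"
      unfolding integral_ideal_def using submodule_plus_principal[OF subQ] QD a
      by (auto intro!: add_mem mult_mem)
    moreover have "?J \<inter> W = {}" using no by blast
    ultimately have "?J = Q" using max Q(2) by simp
    moreover have "0 + a * 1 \<in> ?J" using submoduleD(1)[OF subQ] one_mem by blast
    ultimately show False using a(2) by simp
  qed
  have "prime_ideal D Q"
    unfolding prime_ideal_def
  proof (intro conjI ballI impI)
    show "Q \<noteq> D"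
    proof
      assume "Q = D"
      then show False using Q(3) assms(2) one_mem by blast
    qed
    fix a b assume ab: "a \<in> D" "b \<in> D" "a * b \<in> Q"
    show "a \<in> Q \<or> b \<in> Q"
    proof (rule ccontr)
      assume "\<not> (a \<in> Q \<or> b \<in> Q)"
      then obtain w q r w' q' r' where w: "w \<in> W" "q \<in> Q" "r \<in> D" "w = q + a * r"
        "w' \<in> W" "q' \<in> Q" "r' \<in> D" "w' = q' + b * r'"
        using ext ab by metis
      \<comment> \<open>The product of elements of \<open>Q + a D\<close> and \<open>Q + b D\<close>
        lies in \<open>Q + a b D\<close>, which is inside \<open>Q\<close>; but \<open>W\<close> is
        multiplicatively closed and misses \<open>Q\<close>.\<close>
      have "w * w' = w' * q + (a * r) * q' + (r * r') * (a * b)"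
        using w by (simp add: algebra_simps)
      moreover have "w' \<in> D" using w ab QD by (auto intro!: add_mem mult_mem)
      ultimately have "w * w' \<in> Q"
        using w ab by (auto intro!: submoduleD[OF subQ] mult_mem)
      then show False using assms(3) w Q(3) by blast
    qed
  qed (rule Q(1))
  moreover have "J = Q" if "integral_ideal D J" "Q \<subseteq> J" "J \<inter> W = {}" for J
    using max that Q(2) by blast
  ultimately show ?thesis using that Q by blast
qed

lemma maximal_ideal_exists:
  assumes "integral_ideal D I" "1 \<notin> I"
  obtains Q where "prime_ideal D Q" "I \<subseteq> Q"
    "\<forall>J. integral_ideal D J \<longrightarrow> Q \<subseteq> J \<longrightarrow> 1 \<notin> J \<longrightarrow> J = Q"
proof (rule prime_avoiding[of I "{1}"])
  fix Q assume "prime_ideal D Q" "I \<subseteq> Q"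
    "\<And>J. integral_ideal D J \<Longrightarrow> Q \<subseteq> J \<Longrightarrow> J \<inter> {1} = {} \<Longrightarrow> J = Q"
  then show thesis by (intro that) auto
qed (use assms in auto)

text \<open>Cohen's criterion: a maximal non-finitely generated ideal is prime.\<close>
lemma fin_gen_if_primes_fin_gen:
  assumes primes: "\<And>P. prime_ideal D P \<Longrightarrow> fin_gen D P"
    and "integral_ideal D I"
  shows "fin_gen D I"
proof (rule ccontr)
  assume "\<not> fin_gen D I"
  let ?A = "{J. integral_ideal D J \<and> \<not> fin_gen D J}"
  have "\<exists>Q\<in>?A. \<forall>X\<in>?A. Q \<subseteq> X \<longrightarrow> X = Q"
  proof (rule subset_Zorn_nonempty)
    show "?A \<noteq> {}" using \<open>\<not> fin_gen D I\<close> assms by auto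
    fix C assume C: "C \<noteq> {}" "subset.chain ?A C"
    then have CA: "\<And>J. J \<in> C \<Longrightarrow> integral_ideal D J \<and> \<not> fin_gen D J"
      unfolding subset.chain_def by auto
    have "\<not> fin_gen D (\<Union>C)"
    proof
      assume "fin_gen D (\<Union>C)"
      then obtain S where S: "finite S" "\<Union>C = span_over D S" unfolding fin_gen_def by auto
      then obtain B where B: "B \<in> C" "S \<subseteq> B"
        using finite_subset_Union_chain[OF S(1) _ C] span_over_superset[of S D] by blast
      then have "span_over D S \<subseteq> B"
        using CA[OF B(1)] unfolding integral_ideal_def by (intro span_over_minimal) auto
      then have "B = span_over D S" using B(1) S(2) by auto
      then show False using CA[OF B(1)] S(1) unfolding fin_gen_def by auto
    qed
    then show "\<Union>C \<in> ?A" using integral_ideal_Union_chain[OF C] by auto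
  qed
  then obtain Q where "Q \<in> ?A" and max: "\<forall>X\<in>?A. Q \<subseteq> X \<longrightarrow> X = Q" by blast
  then have Q: "integral_ideal D Q" "\<not> fin_gen D Q" by auto
  have subQ: "submodule D Q" and QD: "Q \<subseteq> D" using Q(1) unfolding integral_ideal_def by auto
  have fg: "fin_gen D J" if "integral_ideal D J" "Q \<subseteq> J" "J \<noteq> Q" for J
    using max that by blast
  have "prime_ideal D Q"
    unfolding prime_ideal_def
  proof (intro conjI ballI impI)
    have "span_over D {1} \<subseteq> D" by (rule span_over_minimal[OF _ submodule_self]) simp
    moreover have "D \<subseteq> span_over D {1}"
      using submoduleD(3)[OF submodule_span_over, of _ D 1 "{1}"] span_over_superset[of "{1}" D]
      by auto
    ultimately have "fin_gen D D" unfolding fin_gen_def by blast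
    then show "Q \<noteq> D" using Q(2) by auto
    fix a b assume ab: "a \<in> D" "b \<in> D" "a * b \<in> Q"
    show "a \<in> Q \<or> b \<in> Q"
    proof (rule ccontr)
      assume nab: "\<not> (a \<in> Q \<or> b \<in> Q)"
      \<comment> \<open>\<open>Q + a D\<close> and the residual \<open>(Q : a)\<close> both strictly
        contain \<open>Q\<close>, the first by \<open>a\<close> and the second by \<open>b\<close>,
        so both are finitely generated.\<close>
      let ?J = "{q + a * r |q r. q \<in> Q \<and> r \<in> D}"
      let ?L = "{r \<in> D. r * a \<in> Q}"
      have "q + a * 0 \<in> ?J" if "q \<in> Q" for q using that zero_mem by blast
      then have QJ: "Q \<subseteq> ?J" by auto
      have "0 + a * 1 \<in> ?J" using submoduleD(1)[OF subQ] one_mem by blast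
      then have "a \<in> ?J" by simp
      have "fin_gen D ?J"
      proof (rule fg[OF _ QJ])
        show "integral_ideal D ?J"
          unfolding integral_ideal_def using submodule_plus_principal[OF subQ] QD ab
          by (auto intro!: add_mem mult_mem)
        show "?J \<noteq> Q" using \<open>a \<in> ?J\<close> nab by metis
      qed
      then obtain S where S: "finite S" "?J = span_over D S" unfolding fin_gen_def by blast
      have "\<exists>q r. q \<in> Q \<and> r \<in> D \<and> s = q + a * r" if "s \<in> S" for s
        using span_over_superset[of S D] that S(2) by blast
      then obtain q r where qr: "\<And>s. s \<in> S \<Longrightarrow> q s \<in> Q \<and> r s \<in> D \<and> s = q s + a * r s"
        by metis
      have "fin_gen D ?L"
      proof (rule fg)
        show "integral_ideal D ?L"
          unfolding integral_ideal_def using submodule_residual[OF subQ] by auto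
        show "Q \<subseteq> ?L" using QD submoduleD(3)[OF subQ ab(1)] by (auto simp: mult.commute[of _ a])
        have "b \<in> ?L" using ab by (simp add: mult.commute)
        then show "?L \<noteq> Q" using nab by metis
      qed
      then obtain S' where S': "finite S'" "?L = span_over D S'" unfolding fin_gen_def by blast
      let ?G = "span_over D (q ` S \<union> (*) a ` S')"
      have "?G \<subseteq> Q"
      proof (rule span_over_minimal[OF _ subQ])
        have "S' \<subseteq> ?L" using S'(2) span_over_superset by metis
        then show "q ` S \<union> (*) a ` S' \<subseteq> Q" using qr by (auto simp: mult.commute)
      qed
      moreover have "Q \<subseteq> ?G"
      proof
        fix z assume z: "z \<in> Q"
        \<comment> \<open>Each generator of \<open>Q + a D\<close> splits into a
          \<open>Q\<close>-part and a multiple of \<open>a\<close>. Modulo the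
          \<open>Q\<close>-parts, an element of \<open>Q\<close> is \<open>a * r'\<close> with
          \<open>r'\<close> in \<open>(Q : a)\<close>, so \<open>Q\<close> is generated by the
          \<open>Q\<close>-parts and \<open>a S'\<close>.\<close>
        have "S \<subseteq> {h + a * r |h r. h \<in> span_over D (q ` S) \<and> r \<in> D}"
          using qr span_over_superset[of "q ` S" D] by blast
        then have "?J \<subseteq> {h + a * r |h r. h \<in> span_over D (q ` S) \<and> r \<in> D}"
          unfolding S(2) by (intro span_over_minimal submodule_plus_principal submodule_span_over)
        then have "z \<in> {h + a * r |h r. h \<in> span_over D (q ` S) \<and> r \<in> D}"
          using subsetD[OF QJ z] by (rule subsetD)
        then obtain q' r' where z': "z = q' + a * r'" "q' \<in> span_over D (q ` S)" "r' \<in> D"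
          by auto
        have "span_over D (q ` S) \<subseteq> Q" using qr by (intro span_over_minimal subQ) auto
        then have "z - q' \<in> Q" using z z'(2) by (intro submodule_diff[OF subQ]) auto
        then have "r' \<in> ?L" using z' by (simp add: mult.commute)
        moreover have "submodule D {r. a * r \<in> ?G}"
          using submodule_span_over[of D "q ` S \<union> (*) a ` S'"]
          unfolding submodule_def by (auto simp: distrib_left mult.left_commute)
        then have "span_over D S' \<subseteq> {r. a * r \<in> ?G}"
          by (intro span_over_minimal) (use span_over_superset[of "q ` S \<union> (*) a ` S'" D] in auto)
        ultimately have "a * r' \<in> ?G" using S'(2) by blast
        moreover have "q' \<in> ?G"
          using z'(2) span_over_mono[of "q ` S" "q ` S \<union> (*) a ` S'" D] by auto
        ultimately show "z \<in> ?G" unfolding z'(1) by (intro submoduleD(2)[OF submodule_span_over])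
      qed
      ultimately have "Q = ?G" by blast
      moreover have "finite (q ` S \<union> (*) a ` S')" using S(1) S'(1) by simp
      ultimately show False using Q(2) unfolding fin_gen_def by metis
    qed
  qed (rule Q(1))
  then show False using primes Q(2) by blast
qed

text \<open>The union of the chain is finitely generated, and its finitely many generators already
  lie in one member.\<close>

lemma chain_stabilizes:
  assumes "\<And>I. integral_ideal D I \<Longrightarrow> fin_gen D I"
    and "\<And>n::nat. integral_ideal D (C n)" and "mono C"
  shows "\<exists>N. \<forall>n\<ge>N. C n = C N"
proof -
  have "C i \<subseteq> C j \<or> C j \<subseteq> C i" for i j
    using linear[of i j] monoD[OF \<open>mono C\<close>] by metis
  then have ch: "range C \<noteq> {}" "subset.chain {J. integral_ideal D J} (range C)"
    using assms(2) unfolding subset_chain_def by auto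
  have "fin_gen D (\<Union>(range C))"
    by (rule assms(1)[OF integral_ideal_Union_chain[OF ch]]) simp
  then obtain S where S: "finite S" "\<Union>(range C) = span_over D S"
    unfolding fin_gen_def by metis
  then have "S \<subseteq> \<Union>(range C)" using span_over_superset by metis
  then obtain N where "S \<subseteq> C N"
    by (rule finite_subset_Union_chain[OF S(1) _ ch]) auto
  then have "\<Union>(range C) \<subseteq> C N"
    unfolding S(2) using assms(2) by (intro span_over_minimal) (auto simp: integral_ideal_def)
  then have "C n = C N" if "N \<le> n" for n
    using monoD[OF \<open>mono C\<close> that] by auto
  then show ?thesis by blast
qed

section \<open>Maximal ideals that are t-maximal\<close>

text \<open>Produces an element \<open>d * u\<close> of \<open>(D : A)\<close> outside
  \<open>D\<close>. To treat a further \<open>y\<close>, replace \<open>d\<close> by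
  \<open>y ^ j * d\<close>, where \<open>j\<close> is the last exponent before
  \<open>y ^ j * (d * u)\<close> enters \<open>D\<close>.\<close>

lemma ex_multiplier:
  assumes "finite A" "A \<subseteq> D" "u \<notin> D" "\<And>y. y \<in> A \<Longrightarrow> \<exists>n. y ^ n * u \<in> D"
  shows "\<exists>d\<in>D. d * u \<notin> D \<and> (\<forall>y\<in>A. y * (d * u) \<in> D)"
  using assms(1,2,4)
proof (induction A rule: finite_induct)
  case empty
  then show ?case using assms(3) by (intro bexI[of _ 1]) auto
next
  case (insert y A)
  then obtain d where d: "d \<in> D" "d * u \<notin> D" "\<forall>y\<in>A. y * (d * u) \<in> D" by auto
  obtain n where "y ^ n * u \<in> D" using insert.prems(2) by blast
  then have "d * (y ^ n * u) \<in> D" using d(1) by (rule mult_mem[rotated])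
  then have ex: "y ^ n * (d * u) \<in> D" by (simp add: ac_simps)
  define k where "k = (LEAST n. y ^ n * (d * u) \<in> D)"
  have k: "y ^ k * (d * u) \<in> D" unfolding k_def by (rule LeastI[of "\<lambda>n. y ^ n * (d * u) \<in> D", OF ex])
  then have "k \<noteq> 0" using d(2) by (auto intro: ccontr)
  then obtain j where j: "k = Suc j" using not0_implies_Suc by blast
  have "y ^ j * (d * u) \<notin> D"
    using not_less_Least[of j "\<lambda>n. y ^ n * (d * u) \<in> D"] j unfolding k_def by simp
  moreover have "y * (y ^ j * (d * u)) \<in> D" using k j by (simp add: mult.assoc)
  moreover have y: "y ^ j \<in> D" using insert.prems(1) by (intro power_mem) simp
  moreover have "a * (y ^ j * (d * u)) \<in> D" if "a \<in> A" for a
    using mult_mem[OF y, of "a * (d * u)"] d(3) that by (simp add: ac_simps)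
  ultimately show ?case using d(1) by (intro bexI[of _ "y ^ j * d"]) (auto simp: mult.assoc intro: mult_mem)
qed

text \<open>If \<open>J \<subseteq> Q\<close> is finitely generated, then \<open>s J\<^sup>n \<subseteq> x D\<close> for some \<open>s \<notin> Q\<close>, so
  \<open>(D : J) = D\<close> would give \<open>s / x \<in> D\<close>.\<close>
lemma maximal_t_ideal:
  assumes prime: "prime_ideal D Q"
    and max: "\<And>J. integral_ideal D J \<Longrightarrow> Q \<subseteq> J \<Longrightarrow> 1 \<notin> J \<Longrightarrow> J = Q"
    and x: "x \<in> Q" "x \<noteq> 0"
    and pow: "\<And>y. y \<in> Q \<Longrightarrow> \<exists>s\<in>D - Q. \<exists>n. \<exists>d\<in>D. s * y ^ n = x * d"
  shows "Q \<in> t_Max D"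
proof -
  have Q: "integral_ideal D Q" "Q \<noteq> {0}" using prime x unfolding prime_ideal_def by auto
  have sub: "submodule D Q" "Q \<subseteq> D" using Q(1) unfolding integral_ideal_def by auto
  have one: "1 \<notin> Q"
    using prime submoduleD(3)[OF sub(1), of _ 1] unfolding prime_ideal_def integral_ideal_def by auto
  note fr = integral_imp_fractional[OF Q(1)]
  have "1 \<notin> t_closure D Q"
  proof
    assume "1 \<in> t_closure D Q"
    then obtain A where A: "finite A" "A \<subseteq> Q" "1 \<in> v_closure D A"
      unfolding t_closure_iff[OF fr Q(2)] by blast
    have colon: "colon D A \<subseteq> D" using A(3) unfolding v_closure_def colon_def by auto
    obtain s where s: "\<And>y. y \<in> A \<Longrightarrow> s y \<in> D - Q \<and> (\<exists>n. \<exists>d\<in>D. s y * y ^ n = x * d)"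
      using pow A(2) by (metis subsetD)
    have prod: "prod s F \<in> D - Q" if "finite F" "F \<subseteq> A" for F
      using that
    proof (induction F rule: finite_induct)
      case (insert y F)
      then have "s y \<in> D - Q" "prod s F \<in> D - Q" using s by auto
      then have "s y * prod s F \<in> D - Q"
        using prime mult_mem unfolding prime_ideal_def by blast
      then show ?case using insert.hyps by simp
    qed (use one in simp)
    \<comment> \<open>The product serves all of \<open>A\<close> at once and stays outside the prime
      \<open>Q\<close>. Since \<open>x \<in> Q\<close>, its quotient by \<open>x\<close> is not in
      \<open>D\<close>, whereas some power of each \<open>y \<in> A\<close> multiplies it into
      \<open>D\<close>.\<close>
    let ?u = "prod s A / x"
    have "?u \<notin> D"
    proof
      assume "?u \<in> D"
      then have "?u * x \<in> Q" using x(1) by (rule submoduleD(3)[OF sub(1)])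
      then show False using prod[OF A(1) order_refl] x(2) by simp
    qed
    moreover have "\<exists>n. y ^ n * ?u \<in> D" if y: "y \<in> A" for y
    proof -
      obtain n d where d: "d \<in> D" "s y * y ^ n = x * d" using s[OF y] by blast
      have "prod s A = s y * prod s (A - {y})" using A(1) y by (rule prod.remove)
      then have "y ^ n * ?u = (s y * y ^ n) * prod s (A - {y}) / x" by simp
      also have "\<dots> = d * prod s (A - {y})" using x(2) unfolding d(2) by simp
      finally have "y ^ n * ?u = d * prod s (A - {y})" .
      moreover have "prod s (A - {y}) \<in> D" using prod[of "A - {y}"] A(1) by auto
      ultimately show ?thesis using mult_mem[OF d(1)] by metis
    qed
    ultimately obtain d where "d * ?u \<notin> D" "\<forall>y\<in>A. y * (d * ?u) \<in> D"
      using ex_multiplier[OF A(1), of ?u] A(2) sub(2) by blast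
    moreover from this have "d * ?u \<in> colon D A" unfolding colon_def by (auto simp: ac_simps)
    ultimately show False using colon by blast
  qed
  moreover have "integral_ideal D (t_closure D Q)"
    unfolding integral_ideal_def
    using submodule_t_closure[OF fr Q(2)] t_closure_subset_self[OF Q] by simp
  ultimately have "t_closure D Q = Q" using max subset_t_closure[OF fr Q(2)] by simp
  then have t: "t_ideal D Q" unfolding t_ideal_def using fr Q(2) by simp
  have "Q \<noteq> D" using one by auto
  moreover have "I = Q" if I: "t_ideal D I" "I \<subset> D" "Q \<subseteq> I" for I
  proof (rule max)
    have "submodule D I" using I(1) unfolding t_ideal_def fractional_ideal_def by blast
    then show "integral_ideal D I" "1 \<notin> I"
      using I(2) submoduleD(3)[of D I _ 1] unfolding integral_ideal_def by auto
  qed (rule I(3))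
  ultimately show ?thesis unfolding t_Max_def using t sub(2) by blast
qed

text \<open>By \<open>maxQ\<close>, each maximal ideal \<open>Q\<close> is locally the radical of a
  principal ideal, hence t-maximal. For \<open>z\<close> in the w-closure of \<open>I\<close>, the
  residual \<open>(I : z)\<close> therefore lies in no maximal ideal, so \<open>z \<in> I\<close>;
  and the v-closure of \<open>I\<close> is its w-closure.\<close>

lemma v_closure_eq_self:
  assumes "w_divisorial D" "D \<noteq> UNIV"
    and maxQ: "\<And>Q. prime_ideal D Q \<Longrightarrow>
      (\<And>J. integral_ideal D J \<Longrightarrow> Q \<subseteq> J \<Longrightarrow> 1 \<notin> J \<Longrightarrow> J = Q) \<Longrightarrow>
      \<exists>x\<in>Q. x \<noteq> 0 \<and> (\<forall>y\<in>Q. \<exists>s\<in>D - Q. \<exists>n. \<exists>d\<in>D. s * y ^ n = x * d)"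
    and "fractional_ideal D I" "I \<noteq> {0}"
  shows "v_closure D I = I"
proof -
  have sub: "submodule D I" using assms(4) unfolding fractional_ideal_def by simp
  have "w_closure D I \<subseteq> I"
  proof
    fix z assume z: "z \<in> w_closure D I"
    let ?A = "{r \<in> D. r * z \<in> I}"
    have "1 \<in> ?A"
    proof (rule ccontr)
      have "integral_ideal D ?A" unfolding integral_ideal_def using submodule_residual[OF sub] by auto
      moreover assume "1 \<notin> ?A"
      ultimately obtain Q where Q: "prime_ideal D Q" "?A \<subseteq> Q"
        "\<forall>J. integral_ideal D J \<longrightarrow> Q \<subseteq> J \<longrightarrow> 1 \<notin> J \<longrightarrow> J = Q"
        by (rule maximal_ideal_exists)
      obtain x where "x \<in> Q" "x \<noteq> 0" "\<And>y. y \<in> Q \<Longrightarrow> \<exists>s\<in>D - Q. \<exists>n. \<exists>d\<in>D. s * y ^ n = x * d"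
        using maxQ[OF Q(1)] Q(3) by blast
      then have "Q \<in> t_Max D" using Q(3) by (intro maximal_t_ideal[OF Q(1)]) auto
      then show False using z Q(2) unfolding w_closure_iff[OF sub] by blast
    qed
    then show "z \<in> I" by simp
  qed
  then show ?thesis
    using subset_w_closure[of I] w_closure_eq_v_closure[OF assms(1,2,4,5)] by simp
qed

section \<open>Height one and overrings\<close>

text \<open>The chain from \<open>{0}\<close> to \<open>P\<close> gives height at least one. In a
  chain of length at least two, the member just below \<open>P\<close> strictly contains another
  prime and so is nonzero.\<close>

lemma height_eq_one_iff:
  assumes "prime_ideal D P" "P \<noteq> {0}"
  shows "height D P = 1 \<longleftrightarrow> \<not> (\<exists>Q. prime_ideal D Q \<and> Q \<noteq> {0} \<and> Q \<subset> P)"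
proof -
  define chain where "chain n C \<longleftrightarrow>
    (\<forall>i\<le>n. prime_ideal D (C i)) \<and> (\<forall>i<n. C i \<subset> C (Suc i)) \<and> C n = P"
    for n :: nat and C :: "nat \<Rightarrow> 'a set"
  let ?S = "{enat n |n. \<exists>C. chain n C}"
  have height: "height D P = Sup ?S" unfolding height_def chain_def ..
  have zero: "prime_ideal D {0}"
    unfolding prime_ideal_def integral_ideal_def submodule_def
    using one_mem zero_neq_one by (auto simp del: one_mem)
  have sub: "0 \<in> P" "0 \<in> Q" if "prime_ideal D Q" for Q
    using assms(1) that submoduleD(1)[of D] unfolding prime_ideal_def integral_ideal_def by auto
  show ?thesis
  proof
    assume h: "height D P = 1"
    show "\<not> (\<exists>Q. prime_ideal D Q \<and> Q \<noteq> {0} \<and> Q \<subset> P)"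
    proof
      assume "\<exists>Q. prime_ideal D Q \<and> Q \<noteq> {0} \<and> Q \<subset> P"
      then obtain Q where Q: "prime_ideal D Q" "Q \<noteq> {0}" "Q \<subset> P" by blast
      let ?C = "\<lambda>i::nat. if i = 0 then {0} else if i = 1 then Q else P"
      have "chain 2 ?C"
        using Q zero assms(1) sub[OF Q(1)]
        unfolding chain_def by (auto simp: less_2_cases_iff)
      then have "enat 2 \<in> ?S" by blast
      then have "enat 2 \<le> height D P" unfolding height by (rule Sup_upper)
      then show False using h by (simp add: one_enat_def)
    qed
  next
    assume no: "\<not> (\<exists>Q. prime_ideal D Q \<and> Q \<noteq> {0} \<and> Q \<subset> P)"
    have "n \<le> 1" if C: "chain n C" for n C
    proof (rule ccontr)
      assume "\<not> n \<le> 1"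
      then have "n = Suc (Suc (n - 2))" by simp
      then obtain m where m: "n = Suc (Suc m)" ..
      have C': "prime_ideal D (C m)" "prime_ideal D (C (Suc m))" "C m \<subset> C (Suc m)" "C (Suc m) \<subset> P"
        using C m unfolding chain_def by auto
      have "C (Suc m) \<noteq> {0}" using C'(3) sub(2)[OF C'(1)] by (metis psubsetE singletonD subsetI)
      then show False using no C'(2,4) by metis
    qed
    then have "Sup ?S \<le> 1" by (intro Sup_least) (force simp: one_enat_def)
    moreover have "chain 1 (\<lambda>i::nat. if i = 0 then {0} else P)"
      using zero assms sub(1)[OF zero] unfolding chain_def by auto
    then have "enat 1 \<in> ?S" by blast
    then have "1 \<le> Sup ?S" unfolding one_enat_def by (rule Sup_upper)
    ultimately show "height D P = 1" unfolding height by (rule antisym)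
  qed
qed

lemma domain_in_field_overring:
  assumes "overring D T"
  shows "domain_in_field T"
proof
  show "domain_with_quotient_field T"
    using assms dom unfolding overring_def domain_with_quotient_field_def by blast
qed

lemma overring_localization:
  assumes "prime_ideal D M"
  shows "overring D (localization_at D M)"
  unfolding overring_def subring_of_field_def
proof (intro conjI ballI)
  have M: "submodule D M" "\<And>x y. x \<in> D \<Longrightarrow> y \<in> D \<Longrightarrow> x * y \<in> M \<Longrightarrow> x \<in> M \<or> y \<in> M" "M \<subset> D"
    using assms unfolding prime_ideal_def integral_ideal_def by auto
  have one: "1 \<notin> M" using M submoduleD(3)[OF M(1), of _ 1] by auto
  show D: "D \<subseteq> localization_at D M" by (rule subset_localization_at[OF one])
  then show "1 \<in> localization_at D M" using one_mem by blast
  fix x y assume "x \<in> localization_at D M" "y \<in> localization_at D M"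
  then obtain a s b t where *: "x = a / s" "a \<in> D" "s \<in> D" "s \<notin> M" "y = b / t" "b \<in> D" "t \<in> D" "t \<notin> M"
    unfolding localization_at_def by auto
  then have nz: "s \<noteq> 0" "t \<noteq> 0" using submoduleD(1)[OF M(1)] by auto
  have st: "s * t \<in> D" "s * t \<notin> M" using * M(2) mult_mem by blast+
  have "x - y = (a * t - b * s) / (s * t) \<and> a * t - b * s \<in> D \<and> s * t \<in> D \<and> s * t \<notin> M"
    using * nz st by (simp add: diff_frac_eq diff_mem mult_mem)
  then show "x - y \<in> localization_at D M" unfolding localization_at_def by blast
  have "x * y = (a * b) / (s * t) \<and> a * b \<in> D \<and> s * t \<in> D \<and> s * t \<notin> M"
    using * st by (simp add: mult_mem)
  then show "x * y \<in> localization_at D M" unfolding localization_at_def by blast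
qed

end

section \<open>One-dimensional local domains with \<open>w\<close>-divisorial overrings\<close>

text \<open>Locality is encoded by \<open>inverse_mem\<close>, dimension one by
  \<open>power_dvd\<close>: \<open>N\<close> lies in the radical of every nonzero principal ideal.
  The intended instance is the localization of \<open>R\<close> at a t-maximal ideal.\<close>

locale one_dim_local_domain = domain_in_field D for D :: "'a::field set" +
  fixes N :: "'a set"
  assumes N: "submodule D N" "N \<subset> D" "N \<noteq> {0}"
    and inverse_mem: "\<And>d. d \<in> D \<Longrightarrow> d \<notin> N \<Longrightarrow> inverse d \<in> D"
    and power_dvd: "\<And>x y. x \<in> D \<Longrightarrow> x \<noteq> 0 \<Longrightarrow> y \<in> N \<Longrightarrow> \<exists>n. \<exists>d\<in>D. y ^ n = x * d"
    and w_divisorial_overring: "\<And>T. overring D T \<Longrightarrow> w_divisorial T"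
begin

lemma one_notin_N: "1 \<notin> N"
  using N(2) submoduleD(3)[OF N(1), of _ 1] by auto

lemma proper_ideal_subset:
  assumes "submodule D I" "I \<subseteq> D" "1 \<notin> I"
  shows "I \<subseteq> N"
proof
  fix i assume i: "i \<in> I"
  show "i \<in> N"
  proof (rule ccontr)
    assume no: "i \<notin> N"
    then have "i \<noteq> 0" using submoduleD(1)[OF N(1)] by metis
    moreover have "inverse i * i \<in> I"
      using inverse_mem no assms i by (intro submoduleD(3)[OF assms(1)]) auto
    ultimately show False using assms(3) by simp
  qed
qed

text \<open>Excludes the case in which \<open>w_divisorial\<close> holds by convention.\<close>

lemma D_neq_UNIV: "D \<noteq> UNIV"
proof
  assume D: "D = UNIV"
  obtain c where "c \<in> N" "c \<noteq> 0" using N(1,3) by (rule submodule_neq_zeroE)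
  then have "inverse c * c \<in> N" using D by (intro submoduleD(3)[OF N(1)]) auto
  then show False using \<open>c \<noteq> 0\<close> one_notin_N by simp
qed

lemma overring_self: "overring D D"
  using dom unfolding overring_def domain_with_quotient_field_def by simp

text \<open>By locality the only maximal ideal is \<open>N\<close>, and \<open>power_dvd\<close>
  supplies the divisibility of \<open>v_closure_eq_self\<close> with \<open>s = 1\<close>.\<close>

lemma v_closure_local:
  assumes "fractional_ideal D I" "I \<noteq> {0}"
  shows "v_closure D I = I"
proof (rule v_closure_eq_self[OF w_divisorial_overring[OF overring_self] D_neq_UNIV _ assms])
  fix Q assume Q: "prime_ideal D Q"
    and max: "\<And>J. integral_ideal D J \<Longrightarrow> Q \<subseteq> J \<Longrightarrow> 1 \<notin> J \<Longrightarrow> J = Q"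
  have Q': "submodule D Q" "Q \<subseteq> D" "Q \<noteq> D" using Q unfolding prime_ideal_def integral_ideal_def by auto
  have "1 \<notin> Q" using Q'(2,3) submoduleD(3)[OF Q'(1), of _ 1] by auto
  then have "Q \<subseteq> N" using Q' proper_ideal_subset by metis
  then have "Q = N" using max[of N] N one_notin_N unfolding integral_ideal_def by auto
  obtain x where x: "x \<in> N" "x \<noteq> 0" using N(1,3) by (rule submodule_neq_zeroE)
  have "\<exists>s\<in>D - N. \<exists>n. \<exists>d\<in>D. s * y ^ n = x * d" if "y \<in> N" for y
    using power_dvd[of x y] x N(2) that one_notin_N by (intro bexI[of _ 1]) auto
  then show "\<exists>x\<in>Q. x \<noteq> 0 \<and> (\<forall>y\<in>Q. \<exists>s\<in>D - Q. \<exists>n. \<exists>d\<in>D. s * y ^ n = x * d)"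
    unfolding \<open>Q = N\<close> using x by blast
qed

lemma fractional_N: "fractional_ideal D N"
  using N by (intro integral_imp_fractional) (auto simp: integral_ideal_def)

lemma subset_colon_N: "D \<subseteq> colon D N"
  using N(2) mult_mem unfolding colon_def by blast

text \<open>By duality, \<open>(D : N) / D\<close> is a simple \<open>D\<close>-module.\<close>
lemma colon_N_generated:
  assumes z: "z \<in> colon D N" "z \<notin> D"
  shows "colon D N = {q + z * r |q r. q \<in> D \<and> r \<in> D}" (is "_ = ?I")
proof -
  obtain c where c: "c \<in> N" "c \<noteq> 0" using N(1,3) by (rule submodule_neq_zeroE)
  have sub: "submodule D (colon D N)" by (rule submodule_colon[OF submodule_self])
  have subI: "submodule D ?I" by (rule submodule_plus_principal[OF submodule_self])
  have "?I \<subseteq> colon D N"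
  proof safe
    fix q r assume "q \<in> D" "r \<in> D"
    then have "q \<in> colon D N" "r * z \<in> colon D N"
      using subset_colon_N z(1) submoduleD(3)[OF sub] by auto
    then show "q + z * r \<in> colon D N" using submoduleD(2)[OF sub] by (simp add: mult.commute)
  qed
  then have frI: "fractional_ideal D ?I"
    using fractional_subset[OF fractional_colon[OF c] subI] by simp
  have "1 + z * 0 \<in> ?I" using one_mem zero_mem by blast
  then have one: "1 \<in> ?I" by simp
  then have "?I \<noteq> {0}" by (metis one_neq_zero singletonD)
  have "0 + z * 1 \<in> ?I" using one_mem zero_mem by blast
  then have "z \<in> ?I" by simp
  \<comment> \<open>As \<open>z\<close> lies in \<open>?I\<close> but not in \<open>D\<close>, the
    dual of \<open>?I\<close> is a proper ideal. Dualizing the inclusion in \<open>N\<close> puts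
    \<open>(D : N)\<close> into the v-closure of \<open>?I\<close>, which is
    \<open>?I\<close>.\<close>
  have "colon D ?I \<subseteq> N"
  proof (rule proper_ideal_subset)
    show "submodule D (colon D ?I)" by (rule submodule_colon[OF submodule_self])
    show "colon D ?I \<subseteq> D" by (rule colon_subset[OF one])
    show "1 \<notin> colon D ?I" using colonD[OF _ \<open>z \<in> ?I\<close>, of 1 D] z(2) by auto
  qed
  then have "colon D N \<subseteq> v_closure D ?I" unfolding v_closure_def by (rule colon_mono) simp
  then show ?thesis
    using v_closure_local[OF frI \<open>?I \<noteq> {0}\<close>] \<open>?I \<subseteq> colon D N\<close> by simp
qed

text \<open>Otherwise the v-closure of \<open>N\<close> would be \<open>D\<close>, although
  \<open>N\<close> is divisorial.\<close>

lemma colon_N_not_subset: "\<exists>z. z \<in> colon D N \<and> z \<notin> D"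
proof (rule ccontr)
  assume "\<not> ?thesis"
  then have "colon D N = D" using subset_colon_N by blast
  then have "v_closure D N = D" unfolding v_closure_def by simp
  then show False using v_closure_local[OF fractional_N N(3)] N(2) by simp
qed

text \<open>Here \<open>z * n\<close> is a unit of \<open>D\<close>, and
  \<open>m = inverse (z * n) * (z * m) * n\<close> shows that \<open>n\<close> generates
  \<open>N\<close>.\<close>

lemma fin_gen_N_principal:
  assumes "z \<in> colon D N" "n \<in> N" "z * n \<notin> N"
  shows "fin_gen D N"
proof -
  have zn: "z * n \<in> D" using assms(1,2) unfolding colon_def by auto
  have nz: "z * n \<noteq> 0" using assms(3) submoduleD(1)[OF N(1)] by metis
  have "N \<subseteq> span_over D {n}"
  proof
    fix m assume "m \<in> N"
    then have "z * m \<in> D" using assms(1) unfolding colon_def by auto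
    then have "inverse (z * n) * (z * m) \<in> D" using inverse_mem[OF zn assms(3)] mult_mem by simp
    then have "inverse (z * n) * (z * m) * n \<in> span_over D {n}"
      using span_over_superset[of "{n}" D] by (intro submoduleD(3)[OF submodule_span_over]) auto
    then show "m \<in> span_over D {n}" using nz by (simp add: field_simps)
  qed
  moreover have "span_over D {n} \<subseteq> N" using assms(2) N(1) by (intro span_over_minimal) auto
  ultimately show ?thesis unfolding fin_gen_def by blast
qed

text \<open>The overring \<open>T = (N : N)\<close> is again divisorial. Hence
  \<open>(T : N (T : N)) = ((T : N) : (T : N)) = (N : N) = T\<close>, so that \<open>N\<close> is invertible over \<open>T\<close>.\<close>
lemma fin_gen_N_nonprincipal:
  assumes mult_N: "\<And>z n. z \<in> colon D N \<Longrightarrow> n \<in> N \<Longrightarrow> z * n \<in> N"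
  shows "fin_gen D N"
proof -
  \<comment> \<open>By \<open>mult_N\<close> this colon coincides with \<open>(N : N)\<close>, which
    makes it a ring.\<close>
  define T where "T = colon D N"
  have TN: "z * n \<in> N" if "z \<in> T" "n \<in> N" for z n using mult_N that unfolding T_def by simp
  have memT: "z \<in> T" if "\<And>n. n \<in> N \<Longrightarrow> z * n \<in> N" for z
    using that N(2) unfolding T_def colon_def by blast
  have DT: "D \<subseteq> T" using subset_colon_N unfolding T_def .
  have NT: "N \<subseteq> T" using N(2) DT by blast
  have overT: "overring D T"
    unfolding overring_def subring_of_field_def
  proof (intro conjI ballI)
    show "1 \<in> T" using DT one_mem by blast
    fix x y assume xy: "x \<in> T" "y \<in> T"
    show "x - y \<in> T"
      using xy submodule_diff[OF submodule_colon[OF submodule_self]] unfolding T_def by simp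
    show "x * y \<in> T" using TN xy by (intro memT) (simp add: mult.assoc)
  qed (rule DT)
  interpret T: domain_in_field T by (rule domain_in_field_overring[OF overT])
  obtain c where c: "c \<in> N" "c \<noteq> 0" using N(1,3) by (rule submodule_neq_zeroE)
  have T_UNIV: "T \<noteq> UNIV"
  proof
    assume "T = UNIV"
    then have "inverse c * c \<in> N" using TN c(1) by blast
    then show False using c(2) one_notin_N by simp
  qed
  obtain z where z: "z \<in> T" "z \<notin> D" using colon_N_not_subset unfolding T_def by blast
  have T_gen: "T = {q + y * r |q r. q \<in> D \<and> r \<in> D}" if "y \<in> T" "y \<notin> D" for y
    using colon_N_generated that unfolding T_def by blast
  \<comment> \<open>Any \<open>y \<in> T - D\<close> generates \<open>T\<close> together with 1 over
    \<open>D\<close>. Thus every element of \<open>T\<close> satisfies a monic quadratic equation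
    over \<open>D\<close>.\<close>
  have quadratic: "\<exists>a\<in>D. \<exists>b\<in>D. y * y = a + y * b" if y: "y \<in> T" for y
  proof (cases "y \<in> D")
    case True
    then show ?thesis by (intro bexI[of _ 0] bexI[of _ y]) auto
  next
    case False
    then have "y * y \<in> {q + y * r |q r. q \<in> D \<and> r \<in> D}" using T_gen y T.mult_mem by blast
    then show ?thesis by blast
  qed
  \<comment> \<open>Integrality transports the criterion from \<open>D\<close>: each maximal ideal
    \<open>Q\<close> of \<open>T\<close> contains \<open>N\<close>, and \<open>c \<in> N\<close>
    serves as the divisor.\<close>
  have v_T: "v_closure T I = I" if "fractional_ideal T I" "I \<noteq> {0}" for I
  proof (rule T.v_closure_eq_self[OF w_divisorial_overring[OF overT] T_UNIV _ that])
    fix Q assume Q: "prime_ideal T Q"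
    have subQ: "submodule T Q" and QT: "Q \<subseteq> T" "Q \<noteq> T"
      using Q unfolding prime_ideal_def integral_ideal_def by auto
    have one: "1 \<notin> Q" using QT submoduleD(3)[OF subQ, of _ 1] by auto
    have QN: "a \<in> N" if a: "a \<in> Q" "a \<in> D" for a
    proof (rule ccontr)
      assume no: "a \<notin> N"
      then have "inverse a * a \<in> Q"
        using inverse_mem a DT by (intro submoduleD(3)[OF subQ]) auto
      moreover have "a \<noteq> 0" using no submoduleD(1)[OF N(1)] by metis
      ultimately show False using one by simp
    qed
    assume max: "\<And>J. integral_ideal T J \<Longrightarrow> Q \<subseteq> J \<Longrightarrow> 1 \<notin> J \<Longrightarrow> J = Q"
    \<comment> \<open>If \<open>Q + n T\<close> contained 1, then \<open>1 = q + n * r\<close> with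
      \<open>n * r \<in> N\<close> would put \<open>q\<close> into \<open>D\<close> and
      \<open>Q\<close>, hence into \<open>N\<close>, and so 1 into \<open>N\<close>.\<close>
    have "N \<subseteq> Q"
    proof
      fix n assume n: "n \<in> N"
      let ?J = "{q + n * r |q r. q \<in> Q \<and> r \<in> T}"
      have "1 \<notin> ?J"
      proof
        assume "1 \<in> ?J"
        then obtain q r where qr: "1 = q + n * r" "q \<in> Q" "r \<in> T" by auto
        have nr: "n * r \<in> N" using TN[OF qr(3) n] by (simp add: mult.commute)
        have q: "q = 1 - n * r" using qr(1) by (metis add_diff_cancel_right')
        have "1 - n * r \<in> D" using nr N(2) by (intro diff_mem) auto
        then have "q \<in> N" using QN[OF qr(2)] q by simp
        then have "q + n * r \<in> N" using nr by (rule submoduleD(2)[OF N(1)])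
        then show False using qr(1) one_notin_N by simp
      qed
      moreover have "integral_ideal T ?J"
        unfolding integral_ideal_def
        using T.submodule_plus_principal[OF subQ, of n] QT(1) n NT
        by (auto intro!: T.add_mem T.mult_mem)
      moreover have "q + n * 0 \<in> ?J" if "q \<in> Q" for q using that T.zero_mem by blast
      then have "Q \<subseteq> ?J" by auto
      ultimately have "?J = Q" using max by simp
      moreover have "0 + n * 1 \<in> ?J" using submoduleD(1)[OF subQ] T.one_mem by blast
      ultimately show "n \<in> Q" by simp
    qed
    have "\<exists>s\<in>T - Q. \<exists>n. \<exists>d\<in>T. s * y ^ n = c * d" if y: "y \<in> Q" for y
    proof -
      have yT: "y \<in> T" using y QT by blast
      obtain a b where ab: "a \<in> D" "b \<in> D" "y * y = a + y * b" using quadratic[OF yT] by blast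
      \<comment> \<open>So \<open>a\<close> lies in \<open>Q\<close> and in \<open>D\<close>, hence
        in \<open>N\<close>. If also \<open>b \<in> N\<close>, then \<open>y * y \<in> N\<close> and
        \<open>s = 1\<close> works; otherwise \<open>y - b\<close> is outside \<open>Q\<close>, and
        its \<open>n\<close>-th power is the multiplier that turns \<open>y ^ n\<close> into
        \<open>a ^ n\<close>.\<close>
      have "a = y * (y - b)" using ab(3) by (simp add: algebra_simps)
      moreover have ybT: "y - b \<in> T" using yT ab(2) DT by (intro T.diff_mem) auto
      moreover have "(y - b) * y \<in> Q" using ybT y by (rule submoduleD(3)[OF subQ])
      ultimately have aN: "a \<in> N" using QN ab(1) by (simp add: mult.commute)
      show ?thesis
      proof (cases "b \<in> N")
        case True
        have "y * b \<in> N" by (rule TN[OF yT True])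
        then have "y * y \<in> N" unfolding ab(3) by (intro submoduleD(2)[OF N(1)] aN)
        then obtain n d where "d \<in> D" "(y * y) ^ n = c * d"
          using power_dvd[of c] c N(2) by blast
        then have "1 * y ^ (2 * n) = c * d" by (simp add: power_mult power2_eq_square)
        then show ?thesis using \<open>d \<in> D\<close> DT one T.one_mem by blast
      next
        case False
        have "y - b \<notin> Q"
        proof
          assume "y - b \<in> Q"
          then have "y - (y - b) \<in> Q" by (rule T.submodule_diff[OF subQ y])
          then show False using QN ab(2) False by simp
        qed
        then have "(y - b) ^ n \<in> T - Q" for n
          using prime_ideal_power[OF Q ybT T.one_mem T.power_mem[OF ybT]] T.power_mem[OF ybT] by blast
        moreover obtain n d where "d \<in> D" "a ^ n = c * d" using power_dvd[of c a] c N(2) aN by blast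
        moreover have "(y - b) ^ n * y ^ n = a ^ n"
          unfolding \<open>a = y * (y - b)\<close> by (simp add: power_mult_distrib mult.commute)
        ultimately show ?thesis using DT by (metis subsetD)
      qed
    qed
    then show "\<exists>x\<in>Q. x \<noteq> 0 \<and> (\<forall>y\<in>Q. \<exists>s\<in>T - Q. \<exists>n. \<exists>d\<in>T. s * y ^ n = x * d)"
      using c \<open>N \<subseteq> Q\<close> by blast
  qed
  let ?J = "colon T N"
  have N_T: "submodule T N"
    unfolding submodule_def using submoduleD[OF N(1)] TN by blast
  then have frN: "fractional_ideal T N"
    using NT by (intro T.integral_imp_fractional) (simp add: integral_ideal_def)
  define I where "I = span_over T {n * u |n u. n \<in> N \<and> u \<in> ?J}"
  have subI: "submodule T I" unfolding I_def by (rule submodule_span_over)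
  have gen: "n * u \<in> I" if "n \<in> N" "u \<in> ?J" for n u
    unfolding I_def using that span_over_superset[of "{n * u |n u. n \<in> N \<and> u \<in> ?J}" T] by blast
  have "I \<subseteq> T"
    unfolding I_def using T.submodule_self
    by (intro span_over_minimal) (auto simp: colon_def mult.commute)
  then have frI: "fractional_ideal T I"
    using subI by (intro T.integral_imp_fractional) (simp add: integral_ideal_def)
  have "1 \<in> ?J" using NT unfolding colon_def by auto
  then have "c * 1 \<in> I" using c(1) gen by blast
  then have "I \<noteq> {0}" using c(2) by auto
  have "colon T I \<subseteq> T"
  proof
    fix u assume u: "u \<in> colon T I"
    show "u \<in> T"
    proof (rule memT)
      fix n assume n: "n \<in> N"
      have "u * n * w \<in> T" if "w \<in> ?J" for w
        using gen[OF n that] u unfolding colon_def[of T I] by (auto simp: mult.assoc)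
      then have "u * n \<in> v_closure T N" unfolding v_closure_def colon_def[of T ?J] by blast
      then show "u * n \<in> N" using v_T[OF frN N(3)] by simp
    qed
  qed
  then have "colon T T \<subseteq> v_closure T I" unfolding v_closure_def by (intro colon_mono) auto
  then have "1 \<in> I" using v_T[OF frI \<open>I \<noteq> {0}\<close>] T.one_mem by auto
  \<comment> \<open>The step from \<open>T\<close> back to \<open>D\<close>: \<open>x\<close>
    qualifies if \<open>x N\<close> lies in the \<open>D\<close>-span of a finite subset of
    \<open>N\<close>. A product \<open>n * u\<close> with \<open>u \<in> (T : N)\<close> qualifies
    through \<open>{n, z * n}\<close>, because \<open>u N \<subseteq> T = D + z D\<close>. As
    \<open>1 \<in> I\<close>, also 1 qualifies.\<close>
  let ?X = "{x. \<exists>F. finite F \<and> F \<subseteq> N \<and> (\<forall>m\<in>N. x * m \<in> span_over D F)}"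
  have "submodule T ?X"
    unfolding submodule_def
  proof (intro conjI ballI)
    show "0 \<in> ?X" using submoduleD(1)[OF submodule_span_over] by auto
  next
    fix x y assume "x \<in> ?X" "y \<in> ?X"
    then obtain F G where FG: "finite F" "F \<subseteq> N" "\<forall>m\<in>N. x * m \<in> span_over D F"
      "finite G" "G \<subseteq> N" "\<forall>m\<in>N. y * m \<in> span_over D G" by auto
    have "(x + y) * m \<in> span_over D (F \<union> G)" if "m \<in> N" for m
      unfolding distrib_right
      using FG that span_over_mono[of F "F \<union> G" D] span_over_mono[of G "F \<union> G" D]
      by (intro submoduleD(2)[OF submodule_span_over]) auto
    then show "x + y \<in> ?X" using FG by (intro CollectI exI[of _ "F \<union> G"]) auto
  next
    fix t x assume t: "t \<in> T" and "x \<in> ?X"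
    then obtain F where F: "finite F" "F \<subseteq> N" "\<forall>m\<in>N. x * m \<in> span_over D F" by auto
    have "t * x * m \<in> span_over D F" if "m \<in> N" for m
      using F(3) TN[OF t that] by (metis mult.left_commute mult.assoc)
    then show "t * x \<in> ?X" using F by blast
  qed
  moreover have "n * u \<in> ?X" if n: "n \<in> N" and u: "u \<in> ?J" for n u
  proof -
    have "n * u * m \<in> span_over D {n, z * n}" if "m \<in> N" for m
    proof -
      have "u * m \<in> T" using u that unfolding colon_def by auto
      then obtain q r where qr: "u * m = q + z * r" "q \<in> D" "r \<in> D" using T_gen[OF z] by auto
      have eq: "n * u * m = q * n + r * (z * n)"
        using arg_cong[OF qr(1), of "(*) n"] by (simp add: algebra_simps)
      show ?thesis
        unfolding eq using qr(2,3) span_over_superset[of "{n, z * n}" D]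
        by (intro submoduleD(2)[OF submodule_span_over] submoduleD(3)[OF submodule_span_over qr(2)]
            submoduleD(3)[OF submodule_span_over qr(3)]) auto
    qed
    then show ?thesis using n TN[OF z(1) n] by (intro CollectI exI[of _ "{n, z * n}"]) auto
  qed
  ultimately have "I \<subseteq> ?X" unfolding I_def by (intro span_over_minimal) auto
  then obtain F where F: "finite F" "F \<subseteq> N" "\<forall>m\<in>N. 1 * m \<in> span_over D F"
    using \<open>1 \<in> I\<close> by blast
  have "span_over D F \<subseteq> N" using F(2) N(1) by (rule span_over_minimal)
  then have "N = span_over D F" using F(3) by auto
  then show ?thesis unfolding fin_gen_def using F(1) by blast
qed

text \<open>A nonzero prime contains a power of every element of \<open>N\<close> by
  \<open>power_dvd\<close>, so it equals \<open>N\<close>; Cohen's criterion thus only asks for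
  generators of \<open>N\<close>.\<close>

lemma noetherian:
  assumes "integral_ideal D I"
  shows "fin_gen D I"
proof (rule fin_gen_if_primes_fin_gen[OF _ assms])
  fix P assume P: "prime_ideal D P"
  then have P': "submodule D P" "P \<subseteq> D" "P \<noteq> D" unfolding prime_ideal_def integral_ideal_def by auto
  show "fin_gen D P"
  proof (cases "P = {0}")
    case True
    then show ?thesis unfolding fin_gen_def using span_over_empty[of D] by (intro exI[of _ "{}"]) simp
  next
    case False
    obtain x where x: "x \<in> P" "x \<noteq> 0" using P'(1) False by (rule submodule_neq_zeroE)
    have "1 \<notin> P" using P'(2,3) submoduleD(3)[OF P'(1), of _ 1] by auto
    then have "P \<subseteq> N" using proper_ideal_subset P' by metis
    moreover have "N \<subseteq> P"
    proof
      fix y assume y: "y \<in> N"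
      then obtain n d where d: "d \<in> D" "y ^ n = x * d" using power_dvd[of x y] x P'(2) by blast
      then have "y ^ n \<in> P" using submoduleD(3)[OF P'(1) d(1) x(1)] by (simp add: mult.commute)
      then show "y \<in> P" using prime_ideal_power[OF P _ one_mem power_mem] y N(2) by blast
    qed
    ultimately have "P = N" by simp
    then show ?thesis using fin_gen_N_principal fin_gen_N_nonprincipal by metis
  qed
qed

end

section \<open>Domains with \<open>w\<close>-divisorial \<open>t\<close>-linked overrings\<close>

locale totally_w_divisorial_domain = domain_in_field R for R :: "'a::field set" +
  assumes R_neq_UNIV: "R \<noteq> UNIV"
    and w_divisorial_t_linked: "\<And>T. t_linked_overring R T \<Longrightarrow> w_divisorial T"
begin

lemma w_divisorial_self: "w_divisorial R"
proof (rule w_divisorial_t_linked)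
  have "span_over R J = J" if "integral_ideal R J" for J
    using that span_over_superset[of J R] span_over_minimal[of J J R]
    unfolding integral_ideal_def by auto
  then show "t_linked_overring R R"
    using dom unfolding t_linked_overring_def overring_def domain_with_quotient_field_def by simp
qed

lemma w_eq_v: "fractional_ideal R I \<Longrightarrow> I \<noteq> {0} \<Longrightarrow> w_closure R I = v_closure R I"
  by (rule w_closure_eq_v_closure[OF w_divisorial_self R_neq_UNIV])

text \<open>A finitely generated \<open>J\<close> with \<open>(R : J) = R\<close> has v-closure
  \<open>R\<close>, so it is not inside the t-ideal \<open>M\<close>. An element of \<open>J\<close>
  outside \<open>M\<close> is a unit of \<open>T\<close>, whence \<open>J T = T\<close>.\<close>

lemma t_linked_above_localization:
  assumes M: "M \<in> t_Max R" and T: "overring (localization_at R M) T"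
  shows "t_linked_overring R T"
  unfolding t_linked_overring_def
proof (intro conjI allI impI)
  have RL: "R \<subseteq> localization_at R M" by (rule subset_localization_at[OF t_Max_not_mem_one[OF M]])
  then show "overring R T" using T unfolding overring_def by blast
  then interpret T: domain_in_field T by (rule domain_in_field_overring)
  fix J assume "integral_ideal R J \<and> J \<noteq> {0} \<and> fin_gen R J \<and> colon R J = R"
  then have J: "submodule R J" "J \<subseteq> R" "fin_gen R J" "colon R J = R"
    unfolding integral_ideal_def by auto
  have "\<not> J \<subseteq> M"
  proof
    assume "J \<subseteq> M"
    obtain S where S: "finite S" "J = span_over R S" using J(3) unfolding fin_gen_def by blast
    have "v_closure R S = R"
      using J(4) v_closure_span_over[of S] unfolding S(2) v_closure_def by simp
    moreover have "S \<subseteq> M" using \<open>J \<subseteq> M\<close> S(2) span_over_superset by blast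
    moreover have "t_ideal R M" using M unfolding t_Max_def by blast
    ultimately have "1 \<in> M" using S(1) t_idealD[of M S 1] one_mem by simp
    then show False using t_Max_not_mem_one[OF M] by simp
  qed
  then obtain s where s: "s \<in> J" "s \<notin> M" by blast
  have "submodule R M" using t_Max_prime[OF M] unfolding prime_ideal_def integral_ideal_def by simp
  then have "s \<noteq> 0" using s(2) submoduleD(1) by metis
  have "1 / s = 1 / s \<and> 1 \<in> R \<and> s \<in> R \<and> s \<notin> M" using s J(2) by auto
  then have "1 / s \<in> localization_at R M" unfolding localization_at_def by blast
  then have "1 / s \<in> T" using T unfolding overring_def by blast
  then have "1 / s * s \<in> span_over T J"
    using s(1) span_over_superset[of J T] by (intro submoduleD(3)[OF submodule_span_over]) auto
  then have one: "1 \<in> span_over T J" using \<open>s \<noteq> 0\<close> by simp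
  have "R \<subseteq> T" using RL T unfolding overring_def by blast
  then have "span_over T J \<subseteq> T" using J(2) by (intro span_over_minimal T.submodule_self) auto
  then have "colon T T \<subseteq> colon T (span_over T J)" by (intro colon_mono) auto
  then show "colon T (span_over T J) = T" using colon_subset[OF one, of T] by simp
qed

text \<open>For \<open>0 \<noteq> Q \<subset> P\<close>, \<open>x \<in> Q\<close> and \<open>y \<in> P - Q\<close>, the chain of the divisorial ideals
  \<open>(R : (1, y\<^sup>k / x))\<close> becomes stationary. Dually \<open>y\<^sup>k / x\<close> lies in \<open>(1, y\<^sup>k\<^sup>+\<^sup>1 / x)\<^sub>w\<close>, so
  \<open>(s - b y) y\<^sup>k \<in> x R\<close> with \<open>s - b y\<close> outside a \<open>t\<close>-maximal ideal containing \<open>P\<close>.\<close>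
lemma Mori_imp_t_dimension_one:
  assumes "Mori R"
  shows "t_dimension_one R"
  unfolding t_dimension_one_def
proof (intro allI impI)
  fix P assume tP: "t_prime R P"
  then have P: "prime_ideal R P" "P \<noteq> {0}" "t_ideal R P" unfolding t_prime_def by auto
  have PR: "P \<subset> R" using P(1) unfolding prime_ideal_def integral_ideal_def by auto
  obtain M where M: "M \<in> t_Max R" "P \<subseteq> M" using P(3) PR by (rule t_Max_exists)
  have subM: "submodule R M" "M \<subseteq> R"
    using t_Max_prime[OF M(1)] unfolding prime_ideal_def integral_ideal_def by auto
  show "height R P = 1"
    unfolding height_eq_one_iff[OF P(1,2)]
  proof
    assume "\<exists>Q. prime_ideal R Q \<and> Q \<noteq> {0} \<and> Q \<subset> P"
    then obtain Q where Q: "prime_ideal R Q" "Q \<noteq> {0}" "Q \<subset> P" by blast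
    have subQ: "submodule R Q" "Q \<subseteq> R" using Q(1) unfolding prime_ideal_def integral_ideal_def by auto
    obtain x where x: "x \<in> Q" "x \<noteq> 0" using subQ(1) Q(2) by (rule submodule_neq_zeroE)
    obtain y where y: "y \<in> P" "y \<notin> Q" using Q(3) by blast
    have yR: "y \<in> R" using y(1) PR by blast
    have xR: "x \<in> R" using x(1) subQ(2) by blast
    have pow: "y ^ k \<notin> Q" for k using prime_ideal_power[OF Q(1) yR one_mem power_mem[OF yR]] y(2) by blast
    \<comment> \<open>The generators of \<open>(x, y ^ k)\<close> divided by \<open>x\<close>.
      Having 1 among them makes the colon \<open>C k\<close> an integral ideal, and it contains
      \<open>x\<close>.\<close>
    define A where "A k = {1, y ^ k / x}" for k :: nat
    define C where "C k = colon R (A k)" for k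
    have CR: "C k \<subseteq> R" for k unfolding C_def by (rule colon_subset) (simp add: A_def)
    have "C k \<noteq> {0}" for k
    proof -
      have "x \<in> C k" using x(2) xR power_mem[OF yR] unfolding C_def A_def colon_def by auto
      then show ?thesis using x(2) by auto
    qed
    then have div: "divisorial R (C k)" for k
      unfolding divisorial_def C_def using fractional_colon[of 1 "A k"] by (simp add: A_def)
    have "1 \<notin> C k" for k
    proof
      assume "1 \<in> C k"
      then have "1 * (y ^ k / x) \<in> R" unfolding C_def by (rule colonD) (simp add: A_def)
      then have "y ^ k / x * x \<in> Q" using x(1) by (intro submoduleD(3)[OF subQ(1)]) auto
      then show False using pow x(2) by simp
    qed
    then have proper: "C k \<subset> R" for k using CR one_mem by blast
    have "C k \<subseteq> C (Suc k)" for k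
    proof
      fix u assume u: "u \<in> C k"
      have "u \<in> R" using u CR by blast
      moreover have "u * (y ^ k / x) \<in> R" using u unfolding C_def by (rule colonD) (simp add: A_def)
      then have "y * (u * (y ^ k / x)) \<in> R" by (rule mult_mem[OF yR])
      ultimately show "u \<in> C (Suc k)"
        unfolding C_def A_def colon_def by (auto simp: ac_simps)
    qed
    then obtain k where k: "\<forall>n\<ge>k. C n = C k" using assms div proper unfolding Mori_def by blast
    let ?I = "span_over R (A (Suc k))"
    have one: "1 \<in> ?I" using span_over_superset[of "A (Suc k)" R] unfolding A_def by auto
    have I_eq: "?I \<subseteq> {q + y ^ Suc k / x * r |q r. q \<in> R \<and> r \<in> R}" (is "_ \<subseteq> ?J")
    proof (rule span_over_minimal[OF _ submodule_plus_principal[OF submodule_self]])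
      have "1 + y ^ Suc k / x * 0 \<in> ?J" "0 + y ^ Suc k / x * 1 \<in> ?J" using one_mem zero_mem by blast+
      then show "A (Suc k) \<subseteq> ?J" unfolding A_def by simp
    qed
    have "fractional_ideal R ?I"
      unfolding fractional_ideal_def
    proof (intro conjI bexI[of _ x] ballI)
      fix u assume "u \<in> ?I"
      then obtain q r where qr: "u = q + y ^ Suc k / x * r" "q \<in> R" "r \<in> R" using I_eq by blast
      have "x * u = x * q + y ^ Suc k * r" unfolding qr(1) using x(2) by (simp add: distrib_left)
      then show "x * u \<in> R" using qr xR power_mem[OF yR] by (simp only:) (intro add_mem mult_mem)
    qed (use xR x submodule_span_over in auto)
    moreover have "?I \<noteq> {0}" using one by (metis one_neq_zero singletonD)
    ultimately have "w_closure R ?I = v_closure R (A (Suc k))"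
      using w_eq_v v_closure_span_over by simp
    also have "\<dots> = v_closure R (A k)"
      using spec[OF k, of "Suc k"] unfolding v_closure_def C_def by simp
    finally have "y ^ k / x \<in> w_closure R ?I"
      using subset_v_closure[of "A k" R] unfolding A_def by auto
    then obtain s where s: "s \<in> R - M" "s * (y ^ k / x) \<in> ?I"
      using M(1) unfolding w_closure_iff[OF submodule_span_over] by blast
    then obtain a b where ab: "s * (y ^ k / x) = a + y ^ Suc k / x * b" "a \<in> R" "b \<in> R"
      using I_eq by blast
    \<comment> \<open>The prime \<open>Q\<close> contains \<open>a * x\<close> but no power of
      \<open>y\<close>, so \<open>s - b * y\<close> falls into \<open>Q\<close>, hence into
      \<open>M\<close>; since \<open>b * y \<in> M\<close>, this contradicts
      \<open>s \<notin> M\<close>.\<close>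
    have "(s - b * y) * y ^ k = a * x" using ab(1) x(2) by (simp add: field_simps)
    moreover have "a * x \<in> Q" using submoduleD(3)[OF subQ(1) ab(2) x(1)] .
    moreover have by_M: "b * y \<in> M" using ab(3) y(1) M(2) by (intro submoduleD(3)[OF subM(1)]) auto
    moreover have "s - b * y \<in> R" using s(1) by_M subM(2) by (intro diff_mem) auto
    ultimately have "s - b * y \<in> Q"
      using Q(1) pow power_mem[OF yR] unfolding prime_ideal_def by metis
    then have "s - b * y \<in> M" using Q(3) M(2) by blast
    then have "(s - b * y) + b * y \<in> M" using by_M by (rule submoduleD(2)[OF subM(1)])
    then show False using s(1) by simp
  qed
qed

section \<open>Consequences of t-dimension one\<close>

context
  assumes t_dim: "t_dimension_one R"
begin

lemma no_prime_below_t_Max: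
  assumes "M \<in> t_Max R" "prime_ideal R Q" "Q \<noteq> {0}" "Q \<subseteq> M"
  shows "Q = M"
proof -
  have t: "t_ideal R M" "M \<noteq> {0}" using assms(1) unfolding t_Max_def t_ideal_def by blast+
  then have "t_prime R M" using t_Max_prime[OF assms(1)] unfolding t_prime_def by simp
  then have "height R M = 1" using t_dim unfolding t_dimension_one_def by blast
  then show ?thesis
    using height_eq_one_iff[OF t_Max_prime[OF assms(1)] t(2)] assms(2-4) by blast
qed

text \<open>Otherwise \<open>x R\<close> misses the multiplicative set of all
  \<open>s * y ^ n\<close> with \<open>s \<notin> M\<close>. A prime containing \<open>x\<close> and
  avoiding this set is nonzero and inside \<open>M\<close>, so it equals \<open>M\<close> and yet
  omits \<open>y\<close>.\<close>

lemma power_dvd_locally: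
  assumes M: "M \<in> t_Max R" and x: "x \<in> R" "x \<noteq> 0" and y: "y \<in> M"
  shows "\<exists>s\<in>R - M. \<exists>n. \<exists>d\<in>R. s * y ^ n = x * d"
proof (rule ccontr)
  assume no: "\<not> ?thesis"
  have M': "submodule R M" "M \<subseteq> R" "\<And>a b. a \<in> R \<Longrightarrow> b \<in> R \<Longrightarrow> a * b \<in> M \<Longrightarrow> a \<in> M \<or> b \<in> M"
    using t_Max_prime[OF M] unfolding prime_ideal_def integral_ideal_def by auto
  have yR: "y \<in> R" using y M'(2) by blast
  let ?W = "{s * y ^ n |s n. s \<in> R - M}"
  have zero: "submodule R {0}" unfolding submodule_def by auto
  have I: "integral_ideal R {q + x * r |q r. q \<in> {0} \<and> r \<in> R}"
    unfolding integral_ideal_def using submodule_plus_principal[OF zero] x(1)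
    by (auto intro: mult_mem)
  have W1: "s * y ^ n \<in> ?W" if "s \<in> R - M" for s n using that by blast
  obtain Q where Q: "prime_ideal R Q" "{q + x * r |q r. q \<in> {0} \<and> r \<in> R} \<subseteq> Q" "Q \<inter> ?W = {}"
  proof (rule prime_avoiding[OF I])
    show "1 \<in> ?W" using W1[of 1 0] t_Max_not_mem_one[OF M] by simp
    show "a * b \<in> ?W" if ab: "a \<in> ?W" "b \<in> ?W" for a b
    proof -
      obtain s n t m where st: "a = s * y ^ n" "b = t * y ^ m" "s \<in> R - M" "t \<in> R - M" using ab by auto
      have "s * t \<in> R - M" using st(3,4) M'(3) mult_mem by blast
      then have "s * t * y ^ (n + m) \<in> ?W" by (rule W1)
      then show ?thesis unfolding st(1,2) by (simp add: power_add ac_simps)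
    qed
    show "{q + x * r |q r. q \<in> {0} \<and> r \<in> R} \<inter> ?W = {}"
    proof (rule ccontr)
      assume "\<not> ?thesis"
      then obtain d s n where "d \<in> R" "s \<in> R - M" "0 + x * d = s * y ^ n" by blast
      then show False using no by (metis add_0)
    qed
  qed
  have "0 + x * 1 \<in> Q" using Q(2) one_mem by blast
  then have "Q \<noteq> {0}" using x(2) by auto
  have QR: "Q \<subseteq> R" using Q(1) unfolding prime_ideal_def integral_ideal_def by simp
  have "Q \<subseteq> M"
  proof
    fix q assume q: "q \<in> Q"
    show "q \<in> M"
    proof (rule ccontr)
      assume "q \<notin> M"
      then have "q * y ^ 0 \<in> ?W" using q QR by (intro W1) auto
      then show False using q Q(3) by auto
    qed
  qed
  then have "Q = M" by (rule no_prime_below_t_Max[OF M Q(1) \<open>Q \<noteq> {0}\<close>])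
  moreover have "1 * y ^ 1 \<in> ?W" using t_Max_not_mem_one[OF M] by (intro W1) auto
  ultimately show False using y Q(3) by auto
qed

text \<open>The v-closure is the w-closure, and at \<open>M\<close> itself
  \<open>s * z \<in> M\<close> with \<open>s \<notin> M\<close> forces
  \<open>z \<in> M\<close>.\<close>

lemma v_closure_t_Max:
  assumes M: "M \<in> t_Max R"
  shows "v_closure R M = M"
proof -
  have M': "submodule R M" "M \<subseteq> R" "\<And>a b. a \<in> R \<Longrightarrow> b \<in> R \<Longrightarrow> a * b \<in> M \<Longrightarrow> a \<in> M \<or> b \<in> M"
    using t_Max_prime[OF M] unfolding prime_ideal_def integral_ideal_def by auto
  have fr: "fractional_ideal R M" "M \<noteq> {0}" using M unfolding t_Max_def t_ideal_def by blast+
  have "v_closure R M \<subseteq> R" using v_closure_mono[OF M'(2), of R] by simp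
  moreover have "\<exists>s\<in>R - M. s * z \<in> M" if "z \<in> v_closure R M" for z
    using that M unfolding w_eq_v[OF fr, symmetric] w_closure_iff[OF M'(1)] by blast
  ultimately have "v_closure R M \<subseteq> M" using M'(3) by blast
  then show ?thesis using subset_v_closure by blast
qed

text \<open>With \<open>G = x\<^sup>-\<^sup>1 R \<inter> R\<^sub>M\<close>, any \<open>b \<in> (R : G) - M\<close> works: \<open>G\<close> contains \<open>(R : A)\<close> for the divisorial
  ideal \<open>A = x R\<^sub>N \<inter> R\<close>.\<close>
lemma ex_in_other_t_Max:
  assumes M: "M \<in> t_Max R" and x: "x \<in> R" "x \<noteq> 0"
  shows "\<exists>b\<in>R - M. \<forall>N\<in>t_Max R. x \<in> N \<longrightarrow> N \<noteq> M \<longrightarrow> b \<in> N"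
proof -
  have prime: "\<And>a b. a \<in> R \<Longrightarrow> b \<in> R \<Longrightarrow> a * b \<in> N \<Longrightarrow> a \<in> N \<or> b \<in> N"
    and sub: "submodule R N" "N \<subseteq> R" if "N \<in> t_Max R" for N
    using t_Max_prime[OF that] unfolding prime_ideal_def integral_ideal_def by auto
  have mult: "s * t \<in> R - N" if "N \<in> t_Max R" "s \<in> R - N" "t \<in> R - N" for s t N
    using that prime[OF that(1), of s t] mult_mem by blast
  have incomp: "\<exists>s\<in>N. s \<notin> N'" if "N \<in> t_Max R" "N' \<in> t_Max R" "N \<noteq> N'" for N N'
    using that unfolding t_Max_def by blast
  define G where "G = {g. x * g \<in> R \<and> (\<exists>s\<in>R - M. s * g \<in> R)}"
  have GI: "g \<in> G" if "x * g \<in> R" "s \<in> R - M" "s * g \<in> R" for g s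
    using that unfolding G_def by blast
  have subG: "submodule R G"
    unfolding submodule_def
  proof (intro conjI ballI)
    show "0 \<in> G" using t_Max_not_mem_one[OF M] by (intro GI[of _ 1]) auto
  next
    fix g h assume "g \<in> G" "h \<in> G"
    then obtain s t where st: "x * g \<in> R" "x * h \<in> R" "s \<in> R - M" "s * g \<in> R" "t \<in> R - M" "t * h \<in> R"
      unfolding G_def by auto
    have "t * (s * g) + s * (t * h) \<in> R"
      using st by (intro add_mem mult_mem[of t "s * g"] mult_mem[of s "t * h"]) auto
    then have "s * t * (g + h) \<in> R" by (simp add: algebra_simps)
    moreover have "x * (g + h) \<in> R" using st by (simp add: distrib_left add_mem)
    ultimately show "g + h \<in> G" using mult[OF M st(3,5)] by (intro GI)
  next
    fix d g assume d: "d \<in> R" and "g \<in> G"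
    then obtain s where s: "x * g \<in> R" "s \<in> R - M" "s * g \<in> R" unfolding G_def by auto
    then have "d * (x * g) \<in> R" "d * (s * g) \<in> R" using d by (auto intro: mult_mem)
    then show "d * g \<in> G" using s(2) by (intro GI[of _ s]) (auto simp: ac_simps)
  qed
  have one: "1 \<in> G" using x(1) t_Max_not_mem_one[OF M] by (intro GI[of _ 1]) auto
  have frG: "fractional_ideal R G"
    unfolding fractional_ideal_def using subG x unfolding G_def by blast
  have G0: "G \<noteq> {0}" using one by (metis one_neq_zero singletonD)
  have "w_closure R G \<subseteq> G"
  proof
    fix z assume z: "z \<in> w_closure R G"
    have "x * z \<in> R"
    proof (rule Inter_t_Max_localizations)
      fix N assume "N \<in> t_Max R"
      then obtain s where s: "s \<in> R - N" "s * z \<in> G" using z unfolding w_closure_iff[OF subG] by blast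
      then have "s * (x * z) \<in> R" unfolding G_def by (simp add: ac_simps)
      then show "\<exists>s\<in>R - N. s * (x * z) \<in> R" using s(1) by blast
    qed
    moreover obtain s where s: "s \<in> R - M" "s * z \<in> G" using z M unfolding w_closure_iff[OF subG] by blast
    moreover from this obtain t where "t \<in> R - M" "t * (s * z) \<in> R" unfolding G_def by blast
    ultimately show "z \<in> G" using mult[OF M, of t s] by (intro GI[of _ "t * s"]) (auto simp: mult.assoc)
  qed
  then have vG: "v_closure R G = G" using w_eq_v[OF frG G0] subset_v_closure[of G R] by simp
  \<comment> \<open>Otherwise \<open>(R : M)\<close> lies in \<open>G\<close>, hence in the
    localization at \<open>M\<close>. It lies in the localization at any other t-maximal ideal
    because \<open>M\<close> has elements outside that ideal. So
    \<open>(R : M) \<subseteq> R\<close>, contrary to \<open>M\<close> being divisorial.\<close>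
  have "\<not> colon R G \<subseteq> M"
  proof
    assume "colon R G \<subseteq> M"
    then have le: "colon R M \<subseteq> G"
      using vG colon_mono[of "colon R G" M R R] unfolding v_closure_def by simp
    have "colon R M \<subseteq> R"
    proof
      fix g assume g: "g \<in> colon R M"
      show "g \<in> R"
      proof (rule Inter_t_Max_localizations)
        fix N assume N: "N \<in> t_Max R"
        show "\<exists>s\<in>R - N. s * g \<in> R"
        proof (cases "N = M")
          case True
          then show ?thesis using le g unfolding G_def by blast
        next
          case False
          then obtain s where s: "s \<in> M" "s \<notin> N" using incomp[OF M N] by blast
          moreover have "s * g \<in> R" using colonD[OF g s(1)] by (simp add: mult.commute)
          ultimately show ?thesis using sub(2)[OF M] by blast
        qed
      qed
    qed
    then have "colon R R \<subseteq> v_closure R M" unfolding v_closure_def by (intro colon_mono) auto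
    then have "1 \<in> v_closure R M" using one_mem by auto
    then show False using v_closure_t_Max[OF M] t_Max_not_mem_one[OF M] by simp
  qed
  then obtain b where b: "b \<in> colon R G" "b \<notin> M" by blast
  moreover have "b \<in> R" using b(1) colon_subset[OF one] by blast
  moreover have "b \<in> N" if N: "N \<in> t_Max R" "x \<in> N" "N \<noteq> M" for N
  proof -
    define A where "A = {r \<in> R. \<exists>s\<in>R - N. \<exists>d\<in>R. s * r = x * d}"
    have AI: "r \<in> A" if "r \<in> R" "s \<in> R - N" "d \<in> R" "s * r = x * d" for r s d
      using that unfolding A_def by blast
    have one': "1 \<in> R - N" using t_Max_not_mem_one[OF N(1)] by simp
    have subA: "submodule R A"
      unfolding submodule_def
    proof (intro conjI ballI)
      show "0 \<in> A" by (rule AI[OF _ one', of _ 0]) auto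
    next
      fix g h assume "g \<in> A" "h \<in> A"
      then obtain s d t e where st: "g \<in> R" "s \<in> R - N" "d \<in> R" "s * g = x * d"
        "h \<in> R" "t \<in> R - N" "e \<in> R" "t * h = x * e" unfolding A_def by auto
      have "s * t * (g + h) = t * (s * g) + s * (t * h)" by (simp add: algebra_simps)
      also have "\<dots> = x * (t * d + s * e)" unfolding st(4,8) by (simp add: algebra_simps)
      finally have "s * t * (g + h) = x * (t * d + s * e)" .
      moreover have "t * d + s * e \<in> R" using st by (intro add_mem mult_mem) auto
      ultimately show "g + h \<in> A" using mult[OF N(1) st(2,6)] add_mem st(1,5) by (intro AI)
    next
      fix r g assume r: "r \<in> R" and "g \<in> A"
      then obtain s d where s: "g \<in> R" "s \<in> R - N" "d \<in> R" "s * g = x * d" unfolding A_def by auto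
      have "s * (r * g) = r * (s * g)" by (simp add: ac_simps)
      also have "\<dots> = x * (r * d)" unfolding s(4) by (simp add: ac_simps)
      finally show "r * g \<in> A" using s r by (intro AI[of _ s "r * d"] mult_mem) auto
    qed
    have AR: "A \<subseteq> R" unfolding A_def by blast
    have xA: "x \<in> A" by (rule AI[OF x(1) one', of 1]) auto
    have frA: "fractional_ideal R A"
      using subA AR by (intro integral_imp_fractional) (simp add: integral_ideal_def)
    have A0: "A \<noteq> {0}" using xA x(2) by (metis singletonD)
    have "v_closure R A \<subseteq> A"
    proof
      fix z assume z: "z \<in> v_closure R A"
      have zR: "z \<in> R" using z v_closure_mono[OF AR, of R] by auto
      obtain s where s: "s \<in> R - N" "s * z \<in> A"
        using z N(1) unfolding w_eq_v[OF frA A0, symmetric] w_closure_iff[OF subA] by blast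
      then obtain t d where t: "t \<in> R - N" "d \<in> R" "t * (s * z) = x * d" unfolding A_def by blast
      show "z \<in> A" using t by (intro AI[OF zR mult[OF N(1) t(1) s(1)]]) (auto simp: mult.assoc)
    qed
    moreover have "colon R A \<subseteq> G"
    proof
      fix g assume g: "g \<in> colon R A"
      \<comment> \<open>A power of \<open>a\<close> lies in \<open>A\<close> and remains outside
        \<open>M\<close>, so it is a denominator for \<open>g\<close> at \<open>M\<close>.\<close>
      obtain a where a: "a \<in> N" "a \<notin> M" using incomp[OF N(1) M N(3)] by blast
      obtain s n d where s: "s \<in> R - N" "d \<in> R" "s * a ^ n = x * d"
        using power_dvd_locally[OF N(1) x a(1)] by blast
      have aR: "a \<in> R" using a(1) sub(2)[OF N(1)] by blast
      have "a ^ n \<in> A" using AI[OF power_mem[OF aR] s] .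
      then have "a ^ n * g \<in> R" using colonD[OF g, of "a ^ n"] by (simp add: mult.commute)
      moreover have "a ^ n \<in> R - M"
        using prime_ideal_power[OF t_Max_prime[OF M] aR one_mem power_mem[OF aR]] a(2) power_mem[OF aR] by blast
      moreover have "x * g \<in> R" using colonD[OF g xA] by (simp add: mult.commute)
      ultimately show "g \<in> G" by (intro GI)
    qed
    \<comment> \<open>Dualizing places \<open>b\<close> in \<open>A\<close>, and every element of
      \<open>A\<close> lies in \<open>N\<close> because \<open>x\<close> does.\<close>
    then have "colon R G \<subseteq> v_closure R A" unfolding v_closure_def by (rule colon_mono) simp
    ultimately have "b \<in> A" using b(1) by blast
    then obtain s d where s: "s \<in> R - N" "d \<in> R" "s * b = x * d" unfolding A_def by blast
    have "d * x \<in> N" using s(2) N(2) by (rule submoduleD(3)[OF sub(1)[OF N(1)]])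
    then have "s * b \<in> N" using s(3) by (simp add: mult.commute)
    then show "b \<in> N" using prime[OF N(1), of s b] s(1) \<open>b \<in> R\<close> by blast
  qed
  ultimately show ?thesis by blast
qed

text \<open>The ideal \<open>B\<close> collects the \<open>b\<close> that belong to all but finitely
  many t-maximal ideals containing \<open>x\<close>. By \<open>ex_in_other_t_Max\<close> no
  t-maximal ideal contains \<open>B\<close>, so 1 is in the v-closure of a finite
  \<open>A \<subseteq> B\<close>, and every t-maximal ideal omits a member of
  \<open>A\<close>.\<close>

lemma finite_t_character:
  assumes x: "x \<in> R" "x \<noteq> 0"
  shows "finite {M \<in> t_Max R. x \<in> M}"
proof -
  let ?F = "\<lambda>b. {M \<in> t_Max R. x \<in> M \<and> b \<notin> M}"
  have sub: "submodule R N" "N \<subseteq> R" if "N \<in> t_Max R" for N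
    using t_Max_prime[OF that] unfolding prime_ideal_def integral_ideal_def by auto
  define B where "B = {b \<in> R. finite (?F b)}"
  have "submodule R B"
    unfolding submodule_def
  proof (intro conjI ballI)
    have "?F 0 = {}" using sub(1) submoduleD(1) by blast
    then show "0 \<in> B" unfolding B_def by (simp only: mem_Collect_eq zero_mem finite.emptyI simp_thms)
  next
    fix a b assume ab: "a \<in> B" "b \<in> B"
    have "?F (a + b) \<subseteq> ?F a \<union> ?F b" using sub(1) submoduleD(2) by blast
    then show "a + b \<in> B" using ab unfolding B_def by (auto intro: add_mem finite_subset)
  next
    fix r b assume rb: "r \<in> R" "b \<in> B"
    have "?F (r * b) \<subseteq> ?F b" using sub(1) submoduleD(3) rb(1) by blast
    then show "r * b \<in> B" using rb unfolding B_def by (auto intro: mult_mem finite_subset)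
  qed
  then have B: "integral_ideal R B" unfolding integral_ideal_def B_def by blast
  have "x \<in> B" unfolding B_def using x(1) by simp
  then have B0: "B \<noteq> {0}" using x(2) by (metis singletonD)
  note frB = integral_imp_fractional[OF B]
  have "t_closure R B = R"
  proof (rule ccontr)
    assume "t_closure R B \<noteq> R"
    then have "t_closure R B \<subset> R" using t_closure_subset_self[OF B B0] by blast
    then obtain M where M: "M \<in> t_Max R" "t_closure R B \<subseteq> M"
      using t_Max_exists[OF t_ideal_t_closure[OF B B0]] by blast
    then have "B \<subseteq> M" using subset_t_closure[OF frB B0] by blast
    obtain b where b: "b \<in> R - M" "\<forall>N\<in>t_Max R. x \<in> N \<longrightarrow> N \<noteq> M \<longrightarrow> b \<in> N"
      using ex_in_other_t_Max[OF M(1) x] by blast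
    have "?F b \<subseteq> {M}" using b(2) by blast
    then have "b \<in> B" unfolding B_def using b(1) by (auto intro: finite_subset)
    then show False using \<open>B \<subseteq> M\<close> b(1) by blast
  qed
  then have "1 \<in> t_closure R B" by simp
  then obtain A where A: "finite A" "A \<subseteq> B" "1 \<in> v_closure R A"
    unfolding t_closure_iff[OF frB B0] by blast
  have "{M \<in> t_Max R. x \<in> M} \<subseteq> (\<Union>a\<in>A. ?F a)"
  proof
    fix M assume M: "M \<in> {M \<in> t_Max R. x \<in> M}"
    then have "t_ideal R M" "1 \<notin> M" using t_Max_not_mem_one unfolding t_Max_def by blast+
    then have "\<not> A \<subseteq> M" using t_idealD[OF _ A(1) _ A(3)] by blast
    then show "M \<in> (\<Union>a\<in>A. ?F a)" using M by blast
  qed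
  moreover have "finite (\<Union>a\<in>A. ?F a)" using A(1,2) unfolding B_def by blast
  ultimately show ?thesis by (rule finite_subset)
qed

section \<open>Noetherian localizations and ascending chains\<close>

text \<open>The local theory applies with \<open>N\<close> the extension of \<open>M\<close>:
  \<open>power_dvd\<close> is \<open>power_dvd_locally\<close> with denominators cleared, and every
  overring of the localization is t-linked over \<open>R\<close>.\<close>

lemma noetherian_localization:
  assumes M: "M \<in> t_Max R" and I: "integral_ideal (localization_at R M) I"
  shows "fin_gen (localization_at R M) I"
proof -
  let ?L = "localization_at R M"
  define N where "N = {a / s |a s. a \<in> M \<and> s \<in> R \<and> s \<notin> M}"
  have prime: "prime_ideal R M" by (rule t_Max_prime[OF M])
  have M': "submodule R M" "M \<subseteq> R" "\<And>a b. a \<in> R \<Longrightarrow> b \<in> R \<Longrightarrow> a * b \<in> M \<Longrightarrow> a \<in> M \<or> b \<in> M"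
    using prime unfolding prime_ideal_def integral_ideal_def by auto
  have one: "1 \<notin> M" by (rule t_Max_not_mem_one[OF M])
  have nz: "s \<noteq> 0" if "s \<notin> M" for s using that submoduleD(1)[OF M'(1)] by metis
  have mult: "s * t \<in> R \<and> s * t \<notin> M" if "s \<in> R" "t \<in> R" "s \<notin> M" "t \<notin> M" for s t
    using that M'(3) mult_mem by blast
  have LI: "a / s \<in> ?L" if "a \<in> R" "s \<in> R" "s \<notin> M" for a s
    using that unfolding localization_at_def by blast
  have NI: "a / s \<in> N" if "a \<in> M" "s \<in> R" "s \<notin> M" for a s
    using that unfolding N_def by blast
  have over: "overring R ?L" by (rule overring_localization[OF prime])
  interpret L: domain_in_field ?L by (rule domain_in_field_overring[OF over])
  have "M \<noteq> {0}" using M unfolding t_Max_def t_ideal_def by blast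
  then obtain c where c: "c \<in> M" "c \<noteq> 0" by (rule submodule_neq_zeroE[OF M'(1)])
  interpret one_dim_local_domain ?L N
  proof
    show "submodule ?L N"
      unfolding submodule_def
    proof (intro conjI ballI)
      show "0 \<in> N" using NI[OF submoduleD(1)[OF M'(1)] one_mem one] by simp
    next
      fix x y assume "x \<in> N" "y \<in> N"
      then obtain a s b t where *: "x = a / s" "a \<in> M" "s \<in> R" "s \<notin> M" "y = b / t" "b \<in> M" "t \<in> R" "t \<notin> M"
        unfolding N_def by auto
      have "t * a + s * b \<in> M" using * by (intro submoduleD(2,3)[OF M'(1)]) auto
      then have "(t * a + s * b) / (s * t) \<in> N" using mult[of s t] * by (intro NI) auto
      then show "x + y \<in> N" using * nz by (simp add: add_frac_eq ac_simps)
    next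
      fix x y assume "x \<in> ?L" "y \<in> N"
      then obtain a s b t where *: "x = a / s" "a \<in> R" "s \<in> R" "s \<notin> M" "y = b / t" "b \<in> M" "t \<in> R" "t \<notin> M"
        unfolding localization_at_def N_def by auto
      have "(a * b) / (s * t) \<in> N" using mult[of s t] * by (intro NI submoduleD(3)[OF M'(1)]) auto
      then show "x * y \<in> N" using * by simp
    qed
    have "1 \<notin> N"
    proof
      assume "1 \<in> N"
      then obtain a s where "1 = a / s" "a \<in> M" "s \<notin> M" unfolding N_def by blast
      then show False using nz by (simp add: divide_simps split: if_splits)
    qed
    moreover have "N \<subseteq> ?L" using M'(2) unfolding localization_at_def N_def by blast
    ultimately show "N \<subset> ?L" using L.one_mem by blast
    have "c / 1 \<in> N" using NI[OF c(1) one_mem one] .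
    then show "N \<noteq> {0}" using c(2) by (metis div_by_1 singletonD)
  next
    fix d assume "d \<in> ?L" and d: "d \<notin> N"
    then obtain a s where as: "d = a / s" "a \<in> R" "s \<in> R" "s \<notin> M" unfolding localization_at_def by blast
    then have "a \<notin> M" using d NI by metis
    then have "s / a \<in> ?L" using as by (intro LI)
    then show "inverse d \<in> ?L" using as(1) by simp
  next
    fix x y assume x: "x \<in> ?L" "x \<noteq> 0" and "y \<in> N"
    then obtain b t where bt: "y = b / t" "b \<in> M" "t \<in> R" "t \<notin> M" unfolding N_def by blast
    obtain a s where as: "x = a / s" "a \<in> R" "s \<in> R" "s \<notin> M" using x(1) unfolding localization_at_def by blast
    have "a \<noteq> 0" using as(1) x(2) by auto
    obtain r n d where r: "r \<in> R - M" "d \<in> R" "r * b ^ n = a * d"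
      using power_dvd_locally[OF M as(2) \<open>a \<noteq> 0\<close> bt(2)] by blast
    have tn: "t ^ n \<in> R" "t ^ n \<notin> M"
      using power_mem[OF bt(3)] prime_ideal_power[OF prime bt(3) one_mem power_mem[OF bt(3)]] bt(4) by blast+
    have "s * d / (r * t ^ n) \<in> ?L"
      using mult[of r "t ^ n"] tn r as by (intro LI mult_mem) auto
    moreover have "b ^ n = a * d / r" using r nz[of r] by (simp add: field_simps)
    then have "y ^ n = x * (s * d / (r * t ^ n))"
      unfolding bt(1) as(1) using nz[OF as(4)] by (simp add: power_divide)
    ultimately show "\<exists>n. \<exists>d\<in>?L. y ^ n = x * d" by blast
  next
    fix T assume "overring ?L T"
    then show "w_divisorial T" by (intro w_divisorial_t_linked t_linked_above_localization[OF M])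
  qed
  show ?thesis by (rule noetherian[OF I])
qed

lemma t_dimension_one_imp_Mori: "Mori R"
  unfolding Mori_def
proof (intro allI impI)
  fix C :: "nat \<Rightarrow> 'a set"
  assume C: "(\<forall>n. divisorial R (C n) \<and> C n \<subset> R) \<and> (\<forall>n. C n \<subseteq> C (Suc n))"
  then have sub: "submodule R (C n)" and C0: "C n \<noteq> {0}" and fr: "fractional_ideal R (C n)"
    and v: "v_closure R (C n) = C n" and CR: "C n \<subseteq> R" for n
    unfolding divisorial_def fractional_ideal_def by blast+
  have "mono C" using C by (simp add: mono_iff_le_Suc)
  obtain x where x: "x \<in> C 0" "x \<noteq> 0" using sub C0 by (rule submodule_neq_zeroE)
  have xC: "x \<in> C n" for n using x(1) monoD[OF \<open>mono C\<close>, of 0 n] by blast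
  let ?F = "{M \<in> t_Max R. x \<in> M}"
  let ?L = "\<lambda>M. localization_at R M"
  have "\<exists>N. \<forall>n\<ge>N. span_over (?L M) (C n) = span_over (?L M) (C N)" if M: "M \<in> ?F" for M
  proof -
    have M': "M \<in> t_Max R" using M by simp
    interpret L: domain_in_field "?L M"
      by (rule domain_in_field_overring[OF overring_localization[OF t_Max_prime[OF M']]])
    show ?thesis
    proof (rule L.chain_stabilizes)
      show "fin_gen (?L M) I" if "integral_ideal (?L M) I" for I
        by (rule noetherian_localization[OF M' that])
      have "C n \<subseteq> ?L M" for n
        using CR subset_localization_at[OF t_Max_not_mem_one[OF M']] by blast
      then show "integral_ideal (?L M) (span_over (?L M) (C n))" for n
        unfolding integral_ideal_def
        using submodule_span_over span_over_minimal[OF _ L.submodule_self] by blast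
      show "mono (\<lambda>n. span_over (?L M) (C n))"
        using \<open>mono C\<close> by (intro monoI span_over_mono) (auto dest: monoD)
    qed
  qed
  then obtain f where f: "\<And>M n. M \<in> ?F \<Longrightarrow> n \<ge> f M \<Longrightarrow> span_over (?L M) (C n) = span_over (?L M) (C (f M))"
    by metis
  \<comment> \<open>The sum bounds all thresholds \<open>f M\<close> at once and makes sense even if
    \<open>?F\<close> is empty.\<close>
  define N where "N = sum f ?F"
  have fin: "finite ?F" using finite_t_character x CR by blast
  have fN: "f M \<le> N" if "M \<in> ?F" for M unfolding N_def using that fin by (intro member_le_sum) auto
  have "C n = C N" if n: "n \<ge> N" for n
  proof
    show "C N \<subseteq> C n" using monoD[OF \<open>mono C\<close> n] .
    \<comment> \<open>The divisorial ideal \<open>C N\<close> is its own w-closure, so the inclusion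
      can be checked locally.\<close>
    have "C n \<subseteq> w_closure R (C N)"
    proof
      fix z assume z: "z \<in> C n"
      show "z \<in> w_closure R (C N)"
        unfolding w_closure_iff[OF sub]
      proof
        fix M assume M: "M \<in> t_Max R"
        show "\<exists>s\<in>R - M. s * z \<in> C N"
        proof (cases "x \<in> M")
          case True
          then have "M \<in> ?F" using M by simp
          then have "span_over (?L M) (C n) = span_over (?L M) (C N)"
            using f[of M n] f[of M N] fN[of M] n by simp
          then have "z \<in> span_over (?L M) (C N)" using z span_over_superset[of "C n" "?L M"] by blast
          then show ?thesis using span_over_localization[OF t_Max_prime[OF M] sub] by blast
        next
          case False
          \<comment> \<open>Away from \<open>M\<close> the element \<open>x\<close>, common to all
            members of the chain, is itself the required multiplier.\<close>
          have "z * x \<in> C N" using z CR xC by (intro submoduleD(3)[OF sub]) auto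
          then show ?thesis using False xC CR by (intro bexI[of _ x]) (auto simp: mult.commute)
        qed
      qed
    qed
    also have "\<dots> = C N" using w_eq_v[OF fr C0] v by simp
    finally show "C n \<subseteq> C N" .
  qed
  then show "\<exists>N. \<forall>n\<ge>N. C n = C N" by blast
qed

end

end

theorem corollary4p12:
  fixes R :: "'a::field set"
  assumes "domain_with_quotient_field R"
    and "R \<noteq> UNIV"
    and "\<And>T. t_linked_overring R T \<Longrightarrow> w_divisorial T"
  shows "Mori R \<longleftrightarrow> t_dimension_one R"
proof -
  interpret totally_w_divisorial_domain R
    using assms by unfold_locales
  show ?thesis using Mori_imp_t_dimension_one t_dimension_one_imp_Mori by blast
qed

end
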